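(* Let $d\ge1$, $n\ge\max\{2,d\}$, and let $\xi_1,\dots,\xi_n$ be random vectors in $\mathbb{R}^d$ such that $(\xi_1,\dots,\xi_n)\stackrel{d}{=}(\varepsilon_1\xi_{\sigma(1)},\dots,\varepsilon_n\xi_{\sigma(n)})$ for every permutation $\sigma$ of $\{1,\dots,n\}$ and every $\varepsilon_1,\dots,\varepsilon_n\in\{-1,1\}$ with $\varepsilon_1\cdots\varepsilon_n=1$. Let $S_k=\xi_1+\dots+\xi_k$, $1\le k\le n$, and $S_n^*=S_{n-1}-\xi_n$. Assume that any $d$ random vectors from either collection $S_1,\dots,S_n$ or $S_1,\dots,S_{n-1},S_n^*$ are linearly independent a.s. Then $$\mathbb{P}[0\in\mathrm{Conv}(S_1,\dots,S_{n-1},S_n,S_n^* )]=\frac{2}{2^{n-1}n!}\big(D(n,d+1)+D(n,d+3)+\dots\big),$$ where $D(n,k)$ are defined by $(t+1)(t+3)\cdots(t+2n-3)(t+n-1)=\sum_{k=0}^nD(n,k)t^k$, with $D(n,k)=0$ for $k\notin\{0,\dots,n\}$.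
   Context: $\mathrm{Conv}$ denotes the convex hull. *)

theory Defs
  imports "HOL-Probability.Probability" "HOL-Computational_Algebra.Polynomial"
begin

text \<open>The polynomial (t+1)(t+3)...(t+2n-3)(t+n-1) and its coefficients D(n,k).
  For k > n the coefficient is 0 automatically.\<close>
definition Dpoly :: "nat \<Rightarrow> int poly" where
  "Dpoly n = (\<Prod>i\<in>{1..n-1}. [:int (2*i - 1), 1:]) * [:int n - 1, 1:]"

definition Dcoef :: "nat \<Rightarrow> nat \<Rightarrow> int" where
  "Dcoef n k = coeff (Dpoly n) k"

definition psum :: "(nat \<Rightarrow> 'a \<Rightarrow> 'b::real_vector) \<Rightarrow> nat \<Rightarrow> 'a \<Rightarrow> 'b" where
  "psum \<xi> k \<omega> = (\<Sum>i\<in>{1..k}. \<xi> i \<omega>)"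

definition psum_star :: "(nat \<Rightarrow> 'a \<Rightarrow> 'b::real_vector) \<Rightarrow> nat \<Rightarrow> 'a \<Rightarrow> 'b" where
  "psum_star \<xi> n \<omega> = psum \<xi> (n - 1) \<omega> - \<xi> n \<omega>"

definition psum_alt :: "(nat \<Rightarrow> 'a \<Rightarrow> 'b::real_vector) \<Rightarrow> nat \<Rightarrow> nat \<Rightarrow> 'a \<Rightarrow> 'b" where
  "psum_alt \<xi> n k \<omega> = (if k = n then psum_star \<xi> n \<omega> else psum \<xi> k \<omega>)"

end

theory Submission
  imports Defs
begin

text \<open>
  Let \<open>L\<close> be the space of linear relations \<open>\<Sum>\<^sub>i x\<^sub>i \<xi>\<^sub>i = 0\<close> in \<open>\<real>\<^sup>n\<close>. Summation by parts
  shows that \<open>0\<close> lies in the convex hull of the walk and \<open>S\<^sub>n\<^sup>*\<close> iff \<open>L\<close> meets the Weyl chamber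
  \<open>x\<^sub>1 \<ge> \<dots> \<ge> x\<^sub>n\<^sub>-\<^sub>1 \<ge> \<bar>x\<^sub>n\<bar>\<close> of type \<open>D\<^sub>n\<close> outside the origin, which under general position
  means that \<open>L\<close> meets its interior. By exchangeability the
  probability is the expected number of chambers met by \<open>L\<close>, divided by the order of the Weyl group.
  This number is almost surely constant. It is the number of regions cut out of \<open>L\<close> by the
  hyperplanes of type \<open>D\<^sub>n\<close>; adding the hyperplanes one at a time turns it into a recursion in \<open>n\<close>
  and the codimension \<open>d\<close> of \<open>L\<close>, first for type \<open>B\<close>, from which type \<open>D\<close> arises by deleting
  the coordinate hyperplanes.
\<close>

section \<open>Regions of an arrangement of hyperplanes\<close>

text \<open>The hypotheses speak of two walks only, but independence is needed for every signed
  permutation of the steps. Exchangeability supplies the even sign patterns. Negating the last step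
  turns S_n into S_n^* and supplies the odd ones: this is the purpose of the second collection.

  A chamber whose closure meets L outside 0 is met in its interior for the following reason. A
  nonzero x in L has at least d nonzero absolute values, and any target y can be corrected by an odd
  function phi of the coordinates of x so that y + phi(x) lies in L. Such a correction respects
  every tie between x_i and plus or minus x_j, so the tie is broken exactly as y breaks it.

  Genericity is phrased by levels and by d + 1 vectors because this form survives the two operations
  of the recursion: restriction to a hyperplane (same d) and forgetting a coordinate (d - 1). The
  product defining D(n,k) is, up to signs, the characteristic polynomial of the type D arrangement;
  t + 2n - 1 = (t + n - 1) + n is the algebraic form of deleting the n coordinate
  hyperplanes.\<close>

definition lin_closed :: "('i \<Rightarrow> real) set \<Rightarrow> bool" where
  "lin_closed L \<longleftrightarrow> (\<lambda>_. 0) \<in> L \<and> (\<forall>x\<in>L. \<forall>y\<in>L. \<forall>a. (\<lambda>i. x i + a * y i) \<in> L)"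

definition lin_fun :: "(('i \<Rightarrow> real) \<Rightarrow> real) \<Rightarrow> bool" where
  "lin_fun f \<longleftrightarrow> (\<forall>x y a. f (\<lambda>i. x i + a * y i) = f x + a * f y)"

text \<open>For linear \<open>L\<close> and linear functionals, the points with a given sign pattern
  form a convex cell, so a region can be encoded by the functionals positive on it and counted
  without topology.\<close>

definition regions :: "(('i \<Rightarrow> real) \<Rightarrow> real) set \<Rightarrow> ('i \<Rightarrow> real) set \<Rightarrow> (('i \<Rightarrow> real) \<Rightarrow> real) set set" where
  "regions F L = (\<lambda>x. {f \<in> F. f x > 0}) ` {x \<in> L. \<forall>f\<in>F. f x \<noteq> 0}"

lemma lin_closedD: "lin_closed L \<Longrightarrow> x \<in> L \<Longrightarrow> y \<in> L \<Longrightarrow> (\<lambda>i. x i + a * y i) \<in> L"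
  by (auto simp: lin_closed_def)

lemma lin_closed_scale: "lin_closed L \<Longrightarrow> y \<in> L \<Longrightarrow> (\<lambda>i. a * y i) \<in> L"
  using lin_closedD[of L "\<lambda>_. 0" y a] by (auto simp: lin_closed_def)

lemma lin_funD: "lin_fun f \<Longrightarrow> f (\<lambda>i. x i + a * y i) = f x + a * f y"
  by (auto simp: lin_fun_def)

lemma finite_regions: "finite F \<Longrightarrow> finite (regions F L)"
  by (rule finite_subset[of _ "Pow F"]) (auto simp: regions_def)

lemma lin_closed_ker:
  assumes "lin_closed L" "lin_fun h"
  shows "lin_closed {x \<in> L. h x = 0}"
proof -
  have "h (\<lambda>_. 0) = h (\<lambda>_. 0) + 1 * h (\<lambda>_. 0)"
    using lin_funD[OF assms(2), of "\<lambda>_. 0" 1 "\<lambda>_. 0"] by simp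
  then show ?thesis
    using assms by (auto simp: lin_closed_def lin_fun_def)
qed

lemma small_perturbation:
  fixes a b :: real
  assumes "a > 0"
  shows "\<forall>\<^sub>F t in at_right 0. a + t * b > 0"
proof -
  have "((\<lambda>t. a + t * b) \<longlongrightarrow> a + 0 * b) (at_right 0)"
    by (intro tendsto_intros)
  then show ?thesis using assms order_tendstoD(1) by fastforce
qed

lemma perturb_signs:
  fixes p q :: "'f \<Rightarrow> real"
  assumes "finite F" "\<And>f. f \<in> F \<Longrightarrow> p f \<noteq> 0"
  shows "\<exists>t>0. \<forall>f\<in>F. p f + t * q f \<noteq> 0 \<and> (p f + t * q f > 0 \<longleftrightarrow> p f > 0)"
proof -
  have "\<forall>\<^sub>F t in at_right 0. \<bar>p f\<bar> + t * (sgn (p f) * q f) > 0" if "f \<in> F" for f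
    using small_perturbation assms(2)[OF that] by auto
  then have "\<forall>\<^sub>F t in at_right 0. \<forall>f\<in>F. \<bar>p f\<bar> + t * (sgn (p f) * q f) > 0"
    using assms(1) by (auto intro: eventually_ball_finite)
  moreover have "\<forall>\<^sub>F t in at_right (0::real). t > 0"
    by (simp add: eventually_at_right_less)
  ultimately have "\<forall>\<^sub>F t in at_right 0. t > 0 \<and> (\<forall>f\<in>F. \<bar>p f\<bar> + t * (sgn (p f) * q f) > 0)"
    by eventually_elim auto
  then obtain t where t: "t > 0" "\<forall>f\<in>F. \<bar>p f\<bar> + t * (sgn (p f) * q f) > 0"
    using eventually_happens[of _ "at_right (0::real)"] by auto
  then show ?thesis
    using assms(2) by (intro exI[of _ t]) (force simp: sgn_if split: if_splits)
qed

text \<open>A region of \<open>F\<close> is cut in two by \<open>h = 0\<close> exactly when it meets this hyperplane.\<close>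

lemma card_regions_insert:
  assumes fin: "finite F" and lf: "\<And>f. f \<in> F \<Longrightarrow> lin_fun f" and lh: "lin_fun h"
    and L: "lin_closed L" and z: "z \<in> L" "h z \<noteq> 0"
  shows "card (regions (insert h F) L) = card (regions F L) + card (regions F {x \<in> L. h x = 0})"
proof (cases "h \<in> F")
  case True
  then have "regions F {x \<in> L. h x = 0} = {}" by (auto simp: regions_def)
  then show ?thesis using True by (simp add: insert_absorb)
next
  case False
  define sg where "sg x = {f \<in> F. f x > 0}" for x
  define nv where "nv = {x \<in> L. \<forall>f\<in>F. f x \<noteq> 0}"
  \<comment> \<open>Patterns on \<open>F\<close> realised on either side of \<open>h = 0\<close> and
    on it. The count is |P| + |N| = |P union N| + |P inter N|, and the intersection turns out to be
    \<open>Z\<close>.\<close>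
  define P where "P = sg ` {x \<in> nv. h x > 0}"
  define N where "N = sg ` {x \<in> nv. h x < 0}"
  define Z where "Z = sg ` {x \<in> nv. h x = 0}"
  have rF: "regions F L = sg ` nv" and rZ: "regions F {x \<in> L. h x = 0} = Z"
    by (auto simp: regions_def sg_def nv_def Z_def)
  have finP: "finite P" "finite N"
    using finite_regions[OF fin, of L] unfolding rF P_def N_def
    by (auto intro: finite_subset[of _ "sg ` nv"])
  \<comment> \<open>Cells are convex cones: two points of one cell on opposite sides of
    \<open>h = 0\<close> combine to a point of that cell on it. So patterns in both \<open>P\<close>
    and \<open>N\<close> lie in \<open>Z\<close>.\<close>
  have comb: "(\<lambda>i. x i + t * y i) \<in> nv \<and> sg (\<lambda>i. x i + t * y i) = sg x"
    if "x \<in> nv" "y \<in> nv" "t > 0" "sg x = sg y" for x y t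
  proof -
    have s: "f x + t * f y \<noteq> 0 \<and> (f x + t * f y > 0 \<longleftrightarrow> f x > 0)" if "f \<in> F" for f
    proof (cases "f x > 0")
      case True
      then have "f y > 0" using \<open>sg x = sg y\<close> \<open>f \<in> F\<close> by (auto simp: sg_def)
      then show ?thesis using True \<open>t > 0\<close> by (smt (verit) mult_pos_pos)
    next
      case False
      then have "f x < 0" "\<not> f y > 0"
        using \<open>sg x = sg y\<close> \<open>f \<in> F\<close> \<open>x \<in> nv\<close> by (auto simp: sg_def nv_def)
      moreover then have "f y < 0" using \<open>y \<in> nv\<close> \<open>f \<in> F\<close> by (force simp: nv_def)
      ultimately show ?thesis using \<open>t > 0\<close> by (smt (verit) mult_pos_neg)
    qed
    show ?thesis using s lf L that
      by (auto simp: sg_def nv_def lin_funD lin_closedD)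
  qed
  \<comment> \<open>Conversely, a small move along a multiple of \<open>z\<close> keeps all signs in
    \<open>F\<close>. With \<open>s\<close> equal to plus or minus \<open>h z\<close> it changes
    \<open>h\<close> by plus or minus t (h z)^2, so it leaves the hyperplane on the desired
    side.\<close>
  have pert: "\<exists>t>0. (\<lambda>i. x i + t * (s * z i)) \<in> nv \<and> sg (\<lambda>i. x i + t * (s * z i)) = sg x"
    if "x \<in> nv" for x s
  proof -
    have fz: "f (\<lambda>i. x i + t * (s * z i)) = f x + t * (s * f z)" if "f \<in> F" for f t
      using lin_funD[OF lf[OF that], of x "t * s" z] by (simp add: mult.assoc)
    have Lz: "(\<lambda>i. x i + t * (s * z i)) \<in> L" for t
      using lin_closedD[OF L _ z(1), of x "t * s"] \<open>x \<in> nv\<close> by (simp add: mult.assoc nv_def)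
    obtain t where "t > 0" "\<forall>f\<in>F. f x + t * (s * f z) \<noteq> 0 \<and> (f x + t * (s * f z) > 0 \<longleftrightarrow> f x > 0)"
      using perturb_signs[OF fin, of "\<lambda>f. f x" "\<lambda>f. s * f z"] \<open>x \<in> nv\<close> by (auto simp: nv_def)
    then show ?thesis using Lz fz by (intro exI[of _ t]) (auto simp: nv_def sg_def)
  qed
  have hz: "h (\<lambda>i. x i + t * (s * z i)) = h x + t * (s * h z)" for x s t
    using lin_funD[OF lh, of x "t * s" z] by (simp add: mult.assoc)
  have hzz: "h z * h z > 0" using z(2) not_real_square_gt_zero by blast
  have Z1: "T \<in> P \<inter> N" if "T \<in> Z" for T
  proof -
    obtain x where x: "x \<in> nv" "h x = 0" "T = sg x" using \<open>T \<in> Z\<close> by (auto simp: Z_def)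
    obtain t where t: "t > 0" "(\<lambda>i. x i + t * (h z * z i)) \<in> nv" "sg (\<lambda>i. x i + t * (h z * z i)) = T"
      using pert[OF x(1), of "h z"] x by auto
    obtain u where u: "u > 0" "(\<lambda>i. x i + u * (-h z * z i)) \<in> nv" "sg (\<lambda>i. x i + u * (-h z * z i)) = T"
      using pert[OF x(1), of "-h z"] x by auto
    have "h (\<lambda>i. x i + t * (h z * z i)) > 0"
      using hz[of x t "h z"] x(2) mult_pos_pos[OF t(1) hzz] by linarith
    then have "T \<in> P" using t unfolding P_def by blast
    moreover have "h (\<lambda>i. x i + u * (-h z * z i)) < 0"
      using hz[of x u "- h z"] x(2) mult_pos_pos[OF u(1) hzz] by simp
    then have "T \<in> N" using u unfolding N_def by blast
    ultimately show ?thesis by simp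
  qed
  have Z2: "T \<in> Z" if TP: "T \<in> P" and TN: "T \<in> N" for T
  proof -
    obtain x y where x: "x \<in> nv" "h x > 0" "T = sg x" and y: "y \<in> nv" "h y < 0" "T = sg y"
      using TP TN unfolding P_def N_def by blast
    define t where "t = h x / (- h y)"
    have t: "t > 0" "h x + t * h y = 0" using x y by (auto simp: t_def field_simps)
    have "(\<lambda>i. x i + t * y i) \<in> nv" "sg (\<lambda>i. x i + t * y i) = T" "h (\<lambda>i. x i + t * y i) = 0"
      using comb[OF x(1) y(1) t(1)] x y t by (auto simp: lin_funD[OF lh])
    then show ?thesis unfolding Z_def by blast
  qed
  have "sg ` nv \<subseteq> P \<union> N"
  proof
    fix T assume "T \<in> sg ` nv"
    then obtain x where x: "x \<in> nv" "T = sg x" by auto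
    show "T \<in> P \<union> N"
    proof (cases "h x = 0")
      case True
      then show ?thesis using Z1 x by (auto simp: Z_def)
    next
      case False
      then have "h x > 0 \<or> h x < 0" by linarith
      then show ?thesis using x unfolding P_def N_def by blast
    qed
  qed
  then have un: "sg ` nv = P \<union> N" by (auto simp: P_def N_def)
  have "regions (insert h F) L = insert h ` P \<union> N"
  proof -
    have "regions (insert h F) L = (\<lambda>x. {f \<in> insert h F. f x > 0}) ` ({x \<in> nv. h x > 0} \<union> {x \<in> nv. h x < 0})"
      unfolding regions_def nv_def by (rule image_cong) auto
    also have "\<dots> = (\<lambda>x. {f \<in> insert h F. f x > 0}) ` {x \<in> nv. h x > 0} \<union>
        (\<lambda>x. {f \<in> insert h F. f x > 0}) ` {x \<in> nv. h x < 0}"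
      by (rule image_Un)
    also have "(\<lambda>x. {f \<in> insert h F. f x > 0}) ` {x \<in> nv. h x > 0} = insert h ` P"
      unfolding P_def image_image sg_def by (rule image_cong) auto
    also have "(\<lambda>x. {f \<in> insert h F. f x > 0}) ` {x \<in> nv. h x < 0} = N"
      unfolding N_def sg_def by (rule image_cong) auto
    finally show ?thesis .
  qed
  moreover have "card (insert h ` P \<union> N) = card (insert h ` P) + card N"
    using finP False by (intro card_Un_disjoint) (auto simp: N_def sg_def)
  moreover have "card (insert h ` P) = card P"
    using False by (intro card_image) (auto simp: inj_on_def P_def sg_def)
  moreover have "card P + card N = card (P \<union> N) + card (P \<inter> N)"
    using finP by (rule card_Un_Int)
  moreover have "P \<inter> N = Z" using Z1 Z2 by blast
  ultimately show ?thesis by (simp add: rF rZ un)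
qed

lemma card_image_eq_of_kernel:
  assumes "\<And>x y. x \<in> X \<Longrightarrow> y \<in> X \<Longrightarrow> f x = f y \<longleftrightarrow> g x = g y"
  shows "card (f ` X) = card (g ` X)"
proof -
  define k where "k t = g (SOME x. x \<in> X \<and> f x = t)" for t
  have k: "k (f x) = g x" if "x \<in> X" for x
  proof -
    have "(SOME y. y \<in> X \<and> f y = f x) \<in> X \<and> f (SOME y. y \<in> X \<and> f y = f x) = f x"
      by (rule someI[of _ x]) (use that in auto)
    then show ?thesis using assms that unfolding k_def by blast
  qed
  have "g ` X = k ` f ` X" using k by (auto simp: image_iff)
  moreover have "inj_on k (f ` X)" using k assms by (auto simp: inj_on_def)
  ultimately show ?thesis by (simp add: card_image)
qed

text \<open>On \<open>L\<close> every hyperplane of \<open>F\<close> is one of \<open>G\<close>. The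
  factor absorbs the signs and multiples that arise when a root is restricted to the hyperplane of
  another root.\<close>

definition subordinate ::
  "('i \<Rightarrow> real) set \<Rightarrow> (('i \<Rightarrow> real) \<Rightarrow> real) set \<Rightarrow> (('i \<Rightarrow> real) \<Rightarrow> real) set \<Rightarrow> bool" where
  "subordinate L F G \<longleftrightarrow> (\<forall>f\<in>F. \<exists>g\<in>G. \<exists>c. c \<noteq> 0 \<and> (\<forall>x\<in>L. f x = c * g x))"

lemma subordinate_signs:
  assumes "subordinate L F G" "x \<in> L" "y \<in> L" "\<forall>g\<in>G. g x \<noteq> 0" "\<forall>g\<in>G. g y \<noteq> 0"
    and "{g \<in> G. g x > 0} = {g \<in> G. g y > 0}"
  shows "(\<forall>f\<in>F. f x \<noteq> 0) \<and> {f \<in> F. f x > 0} = {f \<in> F. f y > 0}"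
proof -
  have "f x \<noteq> 0 \<and> (f x > 0 \<longleftrightarrow> f y > 0)" if "f \<in> F" for f
  proof -
    obtain g c where g: "g \<in> G" "c \<noteq> 0" "\<forall>x\<in>L. f x = c * g x"
      using assms(1) \<open>f \<in> F\<close> unfolding subordinate_def by blast
    have gg: "g x \<noteq> 0" "g y \<noteq> 0" "g x > 0 \<longleftrightarrow> g y > 0"
      using g(1) assms(4,5,6) by blast+
    then have "g x < 0 \<longleftrightarrow> g y < 0" by linarith
    then show ?thesis
      using g(2) gg g(3)[rule_format, OF assms(2)] g(3)[rule_format, OF assms(3)]
      by (auto simp: zero_less_mult_iff)
  qed
  then show ?thesis by blast
qed

text \<open>Mutually subordinate families cut \<open>L\<close> by the same hyperplanes, although
  their cardinalities may differ: several functionals can become proportional on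
  \<open>L\<close>.\<close>

lemma card_regions_cong:
  assumes FG: "subordinate L F G" and GF: "subordinate L G F"
  shows "card (regions F L) = card (regions G L)"
proof -
  have nv: "{x \<in> L. \<forall>f\<in>F. f x \<noteq> 0} = {x \<in> L. \<forall>g\<in>G. g x \<noteq> 0}"
    using subordinate_signs[OF FG _ _ _ _ refl] subordinate_signs[OF GF _ _ _ _ refl] by fast
  have iff: "{f \<in> F. f x > 0} = {f \<in> F. f y > 0} \<longleftrightarrow> {g \<in> G. g x > 0} = {g \<in> G. g y > 0}"
    if xy: "x \<in> {x \<in> L. \<forall>g\<in>G. g x \<noteq> 0}" "y \<in> {x \<in> L. \<forall>g\<in>G. g x \<noteq> 0}" for x y
  proof -
    have x: "x \<in> L" "\<forall>g\<in>G. g x \<noteq> 0" "\<forall>f\<in>F. f x \<noteq> 0"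
      and y: "y \<in> L" "\<forall>g\<in>G. g y \<noteq> 0" "\<forall>f\<in>F. f y \<noteq> 0"
      using xy xy[folded nv] by simp_all
    show ?thesis
      using subordinate_signs[OF FG x(1) y(1) x(2) y(2)] subordinate_signs[OF GF x(1) y(1) x(3) y(3)]
      by argo
  qed
  show ?thesis
    unfolding regions_def nv by (rule card_image_eq_of_kernel) (rule iff)
qed

section \<open>Generic subspaces for the arrangement of type B\<close>

definition coord_root :: "'i \<Rightarrow> ('i \<Rightarrow> real) \<Rightarrow> real" where
  "coord_root i x = x i"

definition pair_root :: "'i \<Rightarrow> 'i \<Rightarrow> real \<Rightarrow> ('i \<Rightarrow> real) \<Rightarrow> real" where
  "pair_root i j s x = x i + s * x j"

text \<open>Both orders of a pair occur, so x_i - x_j comes together with its negative. This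
  enlarges the family but not the number of regions.\<close>

definition roots_D :: "'i set \<Rightarrow> (('i \<Rightarrow> real) \<Rightarrow> real) set" where
  "roots_D I = (\<lambda>(i, j, s). pair_root i j s) ` {(i, j, s). i \<in> I \<and> j \<in> I \<and> i \<noteq> j \<and> s \<in> {-1, 1}}"

definition roots_B :: "'i set \<Rightarrow> (('i \<Rightarrow> real) \<Rightarrow> real) set" where
  "roots_B I = coord_root ` I \<union> roots_D I"

lemma finite_roots_D: "finite I \<Longrightarrow> finite (roots_D I)"
  unfolding roots_D_def
  by (rule finite_imageI, rule finite_subset[of _ "I \<times> I \<times> {-1, 1}"]) auto

lemma finite_roots_B: "finite I \<Longrightarrow> finite (roots_B I)"
  by (simp add: roots_B_def finite_roots_D)

lemma pair_root_in_D: "i \<in> I \<Longrightarrow> j \<in> I \<Longrightarrow> i \<noteq> j \<Longrightarrow> s \<in> {-1, 1} \<Longrightarrow> pair_root i j s \<in> roots_D I"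
  unfolding roots_D_def by (rule image_eqI[of _ _ "(i, j, s)"]) auto

lemma roots_DE:
  assumes "f \<in> roots_D I"
  obtains i j s where "f = pair_root i j s" "i \<in> I" "j \<in> I" "i \<noteq> j" "s \<in> {-1, 1}"
  using assms by (auto simp: roots_D_def)

lemma roots_BE:
  assumes "f \<in> roots_B I"
  obtains (coord) i where "f = coord_root i" "i \<in> I"
  | (pair) i j s where "f = pair_root i j s" "i \<in> I" "j \<in> I" "i \<noteq> j" "s \<in> {-1, 1}"
proof -
  from assms consider "f \<in> coord_root ` I" | "f \<in> roots_D I"
    unfolding roots_B_def by blast
  then show thesis
  proof cases
    case 1
    then show thesis using coord by blast
  next
    case 2
    show thesis by (rule roots_DE[OF 2]) (rule pair)
  qed
qed

lemma lin_fun_coord: "lin_fun (coord_root i)"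
  by (simp add: lin_fun_def coord_root_def)

lemma lin_fun_pair: "lin_fun (pair_root i j s)"
  by (simp add: lin_fun_def pair_root_def algebra_simps)

lemma lin_fun_roots_B: "f \<in> roots_B I \<Longrightarrow> lin_fun f"
  by (elim roots_BE) (simp_all add: lin_fun_coord lin_fun_pair)

lemma roots_B_mono: "I \<subseteq> J \<Longrightarrow> roots_B I \<subseteq> roots_B J"
  unfolding roots_B_def roots_D_def by (intro Un_mono image_mono) auto

definition levels :: "'i set \<Rightarrow> ('i \<Rightarrow> real) \<Rightarrow> real set" where
  "levels I x = (\<lambda>i. \<bar>x i\<bar>) ` I - {0}"

text \<open>A linear space of codimension at most \<open>d\<close> in \<open>\<real>\<^sup>I\<close> that meets the \<open>d\<close>-dimensional
  intersections of hyperplanes of type \<open>B\<close> only in \<open>0\<close>: on such an intersection the absolute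
  values of the coordinates take at most \<open>d\<close> nonzero values. The values of the elements of \<open>L\<close>
  outside \<open>I\<close> are irrelevant.\<close>

definition generic :: "'i set \<Rightarrow> nat \<Rightarrow> ('i \<Rightarrow> real) set \<Rightarrow> bool" where
  "generic I d L \<longleftrightarrow> lin_closed L \<and>
     (\<forall>x\<in>L. card (levels I x) \<le> d \<longrightarrow> (\<forall>i\<in>I. x i = 0)) \<and>
     (\<forall>v :: nat \<Rightarrow> 'i \<Rightarrow> real. \<exists>c z. (\<exists>k\<le>d. c k \<noteq> 0) \<and> z \<in> L \<and> (\<forall>i\<in>I. z i = (\<Sum>k\<le>d. c k * v k i)))"

lemma finite_levels [simp]: "finite I \<Longrightarrow> finite (levels I x)"
  by (simp add: levels_def)

lemma genericD_lin: "generic I d L \<Longrightarrow> lin_closed L"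
  by (simp add: generic_def)

lemma genericD_zero: "generic I d L \<Longrightarrow> x \<in> L \<Longrightarrow> card (levels I x) \<le> d \<Longrightarrow> i \<in> I \<Longrightarrow> x i = 0"
  by (simp add: generic_def)

lemma genericD_codim:
  assumes "generic I d L"
  obtains c z k where "k \<le> d" "c k \<noteq> 0" "z \<in> L" "\<forall>i\<in>I. z i = (\<Sum>k\<le>d. c k * v k i)"
  using assms unfolding generic_def by metis

text \<open>Any d + 1 vectors have a nontrivial combination in \<open>L\<close>; for unit vectors at
  distinct indices such a combination cannot vanish.\<close>

lemma generic_nonzero:
  fixes I :: "'i set"
  assumes g: "generic I d L" and I: "finite I" "d < card I"
  shows "\<exists>x\<in>L. \<exists>i\<in>I. x i \<noteq> 0"
proof -
  obtain h where h: "bij_betw h {0..<card I} I"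
    using ex_bij_betw_nat_finite[OF I(1)] by auto
  have inj: "inj_on h {..d}" and hI: "\<And>k. k \<le> d \<Longrightarrow> h k \<in> I"
    using h I(2) by (auto simp: bij_betw_def inj_on_def)
  obtain c z k where c: "k \<le> d" "c k \<noteq> 0" "z \<in> L"
      "\<forall>i\<in>I. z i = (\<Sum>k\<le>d. c k * (if i = h k then 1 else 0))"
    by (rule genericD_codim[OF g, of "\<lambda>k i. if i = h k then 1 else 0"])
  have "z (h k) = (\<Sum>l\<le>d. c l * (if h k = h l then 1 else 0))"
    using c hI by blast
  also have "\<dots> = (\<Sum>l\<le>d. if l = k then c l else 0)"
    using inj c(1) by (intro sum.cong) (auto simp: inj_on_def)
  also have "\<dots> = c k" using c(1) by simp
  finally show ?thesis using c hI by metis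
qed

lemma odd_step_sum:
  fixes c :: "nat \<Rightarrow> real" and w :: "nat \<Rightarrow> real"
  shows "(\<Sum>k<d. c k * ((if t = w k then 1 else 0) - (if t = - w k then 1 else 0))) =
    - (\<Sum>k<d. c k * ((if - t = w k then 1 else 0) - (if - t = - w k then 1 else 0)))"
proof -
  have *: "t = - w k \<longleftrightarrow> - t = w k" for k by auto
  show ?thesis unfolding * sum_negf[symmetric] by (intro sum.cong) auto
qed

text \<open>Choose \<open>d\<close> levels of \<open>x\<close> and let each define the vector of
  signed indicators of that level. Together with \<open>y\<close> these are d + 1 vectors, so some
  nontrivial combination lies in \<open>L\<close>; division by the coefficient of \<open>y\<close>
  gives the claim. The correction depends on \<open>x i\<close> only, and oddly, so it respects all
  ties of \<open>x\<close> up to sign.\<close>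

lemma generic_perturb:
  fixes I :: "'i set"
  assumes g: "generic I d L" and I: "finite I" and x: "x \<in> L" "i0 \<in> I" "x i0 \<noteq> 0"
  shows "\<exists>\<phi> :: real \<Rightarrow> real. (\<forall>t. \<phi> (- t) = - \<phi> t) \<and> (\<exists>y'\<in>L. \<forall>i\<in>I. y' i = y i + \<phi> (x i))"
proof -
  have "d \<le> card (levels I x)"
    using genericD_zero[OF g x(1) _ x(2)] x(3) by (meson not_le_imp_less order_less_imp_le)
  then obtain V where V: "V \<subseteq> levels I x" "card V = d" "finite V"
    using obtain_subset_with_card_n by metis
  obtain w where w: "bij_betw w {0..<d} V"
    using ex_bij_betw_nat_finite[OF V(3)] V(2) by auto
  have wV: "w k \<in> levels I x" if "k < d" for k
    using w V that by (auto simp: bij_betw_def)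
  have winj: "w k = w l \<longleftrightarrow> k = l" if "k < d" "l < d" for k l
    using w that by (auto simp: bij_betw_def inj_on_def)
  have wpos: "w k > 0" if "k < d" for k
    using wV[OF that] by (auto simp: levels_def)
  define \<psi> where "\<psi> k t = ((if t = w k then 1 else 0) - (if t = - w k then 1 else 0) :: real)" for k t
  \<comment> \<open>The slots below \<open>d\<close> hold the indicator vectors, slot
    \<open>d\<close> holds \<open>y\<close>.\<close>
  obtain c z k where c: "k \<le> d" "c k \<noteq> 0" "z \<in> L"
      "\<forall>i\<in>I. z i = (\<Sum>k\<le>d. c k * (if k < d then \<psi> k (x i) else y i))"
    by (rule genericD_codim[OF g, of "\<lambda>k i. if k < d then \<psi> k (x i) else y i"])
  define \<Phi> where "\<Phi> t = (\<Sum>k<d. c k * \<psi> k t)" for t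
  have z: "z i = \<Phi> (x i) + c d * y i" if "i \<in> I" for i
  proof -
    have "{..d} = insert d {..<d}" by auto
    then have "z i = c d * y i + (\<Sum>k<d. c k * (if k < d then \<psi> k (x i) else y i))"
      using c(4) that by simp
    also have "(\<Sum>k<d. c k * (if k < d then \<psi> k (x i) else y i)) = \<Phi> (x i)"
      unfolding \<Phi>_def by (intro sum.cong) auto
    finally show ?thesis by simp
  qed
  have odd: "\<Phi> (- t) = - \<Phi> t" for t
    unfolding \<Phi>_def \<psi>_def using odd_step_sum[where t = t and c = c and w = w and d = d] by simp
  have \<Phi>w: "\<Phi> (w k) = c k" if "k < d" for k
  proof -
    have "\<Phi> (w k) = (\<Sum>l<d. if l = k then c l else 0)"
      unfolding \<Phi>_def \<psi>_def
    proof (intro sum.cong refl)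
      fix l assume "l \<in> {..<d}"
      then have l: "l < d" by simp
      have "w k \<noteq> - w l" using wpos[OF l] wpos[OF that] by linarith
      then show "c l * ((if w k = w l then 1 else 0) - (if w k = - w l then 1 else 0)) = (if l = k then c l else 0)"
        using winj[OF that l] by auto
    qed
    then show ?thesis using that by simp
  qed
  \<comment> \<open>Without \<open>y\<close> the combination takes only the values 0 and plus or
    minus \<open>c l\<close>, hence has at most \<open>d\<close> levels and vanishes by genericity.
    But at an index of level \<open>w k\<close> its absolute value is that of
    \<open>c k\<close>.\<close>
  have "c d \<noteq> 0"
  proof
    assume 0: "c d = 0"
    then have k: "k < d" using c(1,2) by (cases "k = d") auto
    have "levels I z \<subseteq> (\<lambda>l. \<bar>c l\<bar>) ` {..<d}"
    proof
      fix a assume "a \<in> levels I z"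
      then obtain i where i: "i \<in> I" "a = \<bar>\<Phi> (x i)\<bar>" "a \<noteq> 0"
        using z 0 by (auto simp: levels_def)
      have "\<exists>l<d. x i = w l \<or> x i = - w l"
      proof (rule ccontr)
        assume "\<not> ?thesis"
        then have "\<Phi> (x i) = 0" unfolding \<Phi>_def \<psi>_def by (intro sum.neutral) auto
        then show False using i by simp
      qed
      then obtain l where l: "l < d" "x i = w l \<or> x i = - w l" by auto
      then have "\<bar>\<Phi> (x i)\<bar> = \<bar>c l\<bar>" using odd[of "w l"] \<Phi>w[OF l(1)] by auto
      then show "a \<in> (\<lambda>l. \<bar>c l\<bar>) ` {..<d}" using i l by auto
    qed
    then have "card (levels I z) \<le> d"
      by (metis card_image_le card_lessThan card_mono finite_imageI finite_lessThan le_trans)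
    then have z0: "z i = 0" if "i \<in> I" for i using genericD_zero[OF g c(3)] that by blast
    obtain i where i: "i \<in> I" "w k = \<bar>x i\<bar>" using wV[OF k] by (auto simp: levels_def)
    then have "\<bar>\<Phi> (x i)\<bar> = \<bar>c k\<bar>" using odd[of "x i"] \<Phi>w[OF k] by (auto simp: abs_if split: if_splits)
    then show False using z0[OF i(1)] z[OF i(1)] 0 c(2) by simp
  qed
  then have "\<forall>i\<in>I. (1 / c d) * z i = y i + \<Phi> (x i) / c d"
    using z by (auto simp: field_simps)
  moreover have "(\<lambda>i. (1 / c d) * z i) \<in> L"
    using lin_closed_scale[OF genericD_lin[OF g] c(3)] .
  ultimately show ?thesis
    by (intro exI[of _ "\<lambda>t. \<Phi> t / c d"]) (auto simp: odd)
qed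

text \<open>If \<open>h\<close> vanished on \<open>L\<close>, oddness of the correction would give
  \<open>h\<close> the value 0 on it as well, because \<open>h x = 0\<close> is a tie. Perturbing
  towards the unit vector at \<open>i\<close> then yields an element of \<open>L\<close> on which
  \<open>h\<close> is 1.\<close>

lemma generic_root_nonzero:
  fixes I :: "'i set"
  assumes g: "generic I d L" and I: "finite I" "d < card I" and h: "h \<in> roots_B I"
  shows "\<exists>z\<in>L. h z \<noteq> 0"
proof (rule ccontr)
  assume "\<not> ?thesis"
  then have h0: "h z = 0" if "z \<in> L" for z using that by blast
  obtain x i0 where x: "x \<in> L" "i0 \<in> I" "x i0 \<noteq> 0"
    using generic_nonzero[OF g I] by blast
  have per: "\<exists>\<phi> :: real \<Rightarrow> real. (\<forall>t. \<phi> (- t) = - \<phi> t) \<and> (\<exists>y'\<in>L. \<forall>j\<in>I. y' j = (if j = i then 1 else 0) + \<phi> (x j))" for i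
    using generic_perturb[OF g I(1) x, of "\<lambda>j. if j = i then 1 else 0"] by simp
  from h show False
  proof (cases rule: roots_BE)
    case (coord i)
    obtain \<phi> :: "real \<Rightarrow> real" and y' where p: "\<forall>t. \<phi> (- t) = - \<phi> t" "y' \<in> L"
        "\<forall>j\<in>I. y' j = (if j = i then 1 else 0) + \<phi> (x j)"
      using per[of i] by blast
    have "\<phi> 0 = 0" using p(1)[rule_format, of 0] by simp
    then show False
      using h0[OF x(1)] h0[OF p(2)] p(3) coord by (simp add: coord_root_def)
  next
    case (pair i j s)
    obtain \<phi> :: "real \<Rightarrow> real" and y' where p: "\<forall>t. \<phi> (- t) = - \<phi> t" "y' \<in> L"
        "\<forall>j\<in>I. y' j = (if j = i then 1 else 0) + \<phi> (x j)"
      using per[of i] by blast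
    have "x i = - s * x j" using h0[OF x(1)] pair by (simp add: pair_root_def)
    then have "\<phi> (x i) + s * \<phi> (x j) = 0" using pair(5) p(1) by auto
    moreover have "y' i + s * y' j = 0" using h0[OF p(2)] pair by (simp add: pair_root_def)
    ultimately show False using p(3) pair by (auto simp: algebra_simps)
  qed
qed

section \<open>Genericity under restriction and projection\<close>

text \<open>\<open>s = 0\<close> encodes the coordinate hyperplane, so one lemma covers all
  hyperplanes through coordinate \<open>n\<close>. On each of them coordinate \<open>n\<close> adds
  no new level, and extending vectors on \<open>I\<close> by the value - s v_j places them in the
  hyperplane, so \<open>d\<close> is kept.\<close>

lemma generic_restrict:
  fixes I :: "'i set"
  assumes g: "generic (insert n I) d L" and n: "n \<notin> I" and I: "finite I"
    and s: "s = 0 \<or> (j \<in> I \<and> s \<in> {-1, 1})"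
  shows "generic I d {x \<in> L. x n + s * x j = 0}"
  unfolding generic_def
proof (intro conjI allI ballI impI)
  show "lin_closed {x \<in> L. x n + s * x j = 0}"
    using lin_closed_ker[OF genericD_lin[OF g] lin_fun_pair[of n j s]] by (simp add: pair_root_def)
next
  fix x i assume x: "x \<in> {x \<in> L. x n + s * x j = 0}" "card (levels I x) \<le> d" "i \<in> I"
  then have "x n = - s * x j" by simp
  then have "levels (insert n I) x = levels I x"
    using s by (auto simp: levels_def)
  then show "x i = 0" using genericD_zero[OF g, of x i] x by simp
next
  fix v :: "nat \<Rightarrow> 'i \<Rightarrow> real"
  obtain c z k where c: "k \<le> d" "c k \<noteq> 0" "z \<in> L"
      "\<forall>i\<in>insert n I. z i = (\<Sum>k\<le>d. c k * ((v k)(n := - s * v k j)) i)"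
    by (rule genericD_codim[OF g, of "\<lambda>k. (v k)(n := - s * v k j)"])
  have zI: "\<forall>i\<in>I. z i = (\<Sum>k\<le>d. c k * v k i)"
  proof
    fix i assume "i \<in> I"
    then have "i \<noteq> n" using n by auto
    then show "z i = (\<Sum>k\<le>d. c k * v k i)" using c(4) \<open>i \<in> I\<close> by simp
  qed
  have "z n = - s * (\<Sum>k\<le>d. c k * v k j)"
    using c(4) by (simp add: sum_distrib_left mult_ac sum_negf)
  then have "z n + s * z j = 0" using zI s by auto
  then show "\<exists>c z. (\<exists>k\<le>d. c k \<noteq> 0) \<and> z \<in> {x \<in> L. x n + s * x j = 0} \<and>
      (\<forall>i\<in>I. z i = (\<Sum>k\<le>d. c k * v k i))"
    using c zI by blast
qed

text \<open>Restoring coordinate \<open>n\<close> adds at most one level, which costs one in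
  \<open>d\<close>. For the codimension, \<open>d\<close> vectors on \<open>I\<close> are completed
  by the unit vector at \<open>n\<close>; the combination is not a multiple of it alone, since that
  would have at most one level. For \<open>d = 0\<close> truncated subtraction leaves 0.\<close>

lemma generic_project:
  fixes I :: "'i set"
  assumes g: "generic (insert n I) d L" and n: "n \<notin> I" and I: "finite I"
  shows "generic I (d - 1) L"
proof (cases d)
  case 0
  have z: "x i = 0" if "card (levels I x) \<le> 0" "i \<in> I" for x i
  proof -
    have "levels I x = {}" using that(1) I by simp
    then show ?thesis using that(2) unfolding levels_def by auto
  qed
  show ?thesis
    unfolding generic_def
  proof (intro conjI allI ballI impI)
    show "lin_closed L" using genericD_lin[OF g] .
  next
    fix x i assume "card (levels I x) \<le> d - 1" "i \<in> I"
    then show "x i = 0" using z 0 by simp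
  next
    fix v :: "nat \<Rightarrow> 'i \<Rightarrow> real"
    obtain c z k where "k \<le> d" "c k \<noteq> 0" "z \<in> L" "\<forall>i\<in>insert n I. z i = (\<Sum>k\<le>d. c k * v k i)"
      by (rule genericD_codim[OF g, of v])
    then show "\<exists>c z. (\<exists>k\<le>d - 1. c k \<noteq> 0) \<and> z \<in> L \<and> (\<forall>i\<in>I. z i = (\<Sum>k\<le>d - 1. c k * v k i))"
      using 0 by (intro exI[of _ c] exI[of _ z]) auto
  qed
next
  case (Suc e)
  show ?thesis
    unfolding generic_def
  proof (intro conjI allI ballI impI)
    show "lin_closed L" using genericD_lin[OF g] .
  next
    fix x i assume x: "x \<in> L" "card (levels I x) \<le> d - 1" "i \<in> I"
    have "levels (insert n I) x \<subseteq> insert \<bar>x n\<bar> (levels I x)" by (auto simp: levels_def)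
    then have "card (levels (insert n I) x) \<le> card (insert \<bar>x n\<bar> (levels I x))"
      using I by (intro card_mono) auto
    also have "\<dots> \<le> Suc (card (levels I x))" by (rule card_insert_le_m1) auto
    finally show "x i = 0" using genericD_zero[OF g x(1)] x Suc by simp
  next
    fix v :: "nat \<Rightarrow> 'i \<Rightarrow> real"
    define w where "w k = (if k = d then (\<lambda>i. if i = n then 1 else 0) else v k)" for k
    obtain c z k where c: "k \<le> d" "c k \<noteq> 0" "z \<in> L"
        "\<forall>i\<in>insert n I. z i = (\<Sum>k\<le>d. c k * w k i)"
      by (rule genericD_codim[OF g, of w])
    have zI: "z i = (\<Sum>k\<le>d - 1. c k * v k i) + c d * (if i = n then 1 else 0)" if "i \<in> insert n I" for i
      using c(4)[rule_format, OF that] by (simp add: Suc w_def)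
    have "\<exists>k\<le>d - 1. c k \<noteq> 0"
    proof (rule ccontr)
      assume "\<not> ?thesis"
      then have c0: "c k = 0" if "k \<le> d - 1" for k using that by blast
      then have cd: "c d \<noteq> 0" using c(1,2) Suc by (cases "k = d") auto
      have zI': "z i = c d * (if i = n then 1 else 0)" if "i \<in> insert n I" for i
        using zI[OF that] c0 by simp
      have "levels (insert n I) z \<subseteq> {\<bar>c d\<bar>}" using zI' by (auto simp: levels_def split: if_splits)
      then have "card (levels (insert n I) z) \<le> card {\<bar>c d\<bar>}" by (intro card_mono) auto
      then have "z n = 0" using genericD_zero[OF g c(3), of n] Suc by simp
      then show False using zI'[of n] cd by simp
    qed
    moreover have "\<forall>i\<in>I. z i = (\<Sum>k\<le>d - 1. c k * v k i)" using zI n by auto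
    ultimately show "\<exists>c z. (\<exists>k\<le>d - 1. c k \<noteq> 0) \<and> z \<in> L \<and> (\<forall>i\<in>I. z i = (\<Sum>k\<le>d - 1. c k * v k i))"
      using c(3) by blast
  qed
qed

section \<open>Counting regions of types B and D\<close>

text \<open>The count for a generic subspace of codimension \<open>d\<close>. If \<open>d\<close> is
  at least the dimension, the subspace is 0 on the index set and no region is left. Otherwise the
  first term forgets the new coordinate, and 2n + 1 counts the hyperplanes x_n = 0 and x_n = plus or
  minus x_j.\<close>

fun count_B :: "nat \<Rightarrow> nat \<Rightarrow> nat" where
  "count_B 0 d = 1"
| "count_B (Suc n) d = (if Suc n \<le> d then 0 else count_B n (d - 1) + (2 * n + 1) * count_B n d)"

lemma subordinateI:
  assumes "\<And>f. f \<in> F \<Longrightarrow> \<exists>g\<in>G. \<exists>c. c \<noteq> 0 \<and> (\<forall>x\<in>L. f x = c * g x)"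
  shows "subordinate L F G"
  using assms by (simp add: subordinate_def)

lemma scaled_memI:
  assumes "g \<in> G" "c \<noteq> 0" "\<And>x. x \<in> L \<Longrightarrow> f x = c * g x"
  shows "\<exists>g\<in>G. \<exists>c. c \<noteq> 0 \<and> (\<forall>x\<in>L. f x = c * g x)"
  using assms by blast

lemma subordinate_subset: "F \<subseteq> G \<Longrightarrow> subordinate L F G"
  by (rule subordinateI, rule_tac c = 1 and g = f in scaled_memI) auto

lemma coord_root_in_B: "i \<in> I \<Longrightarrow> coord_root i \<in> roots_B I"
  by (simp add: roots_B_def)

lemma pair_root_in_B: "i \<in> I \<Longrightarrow> j \<in> I \<Longrightarrow> i \<noteq> j \<Longrightarrow> s \<in> {-1, 1} \<Longrightarrow> pair_root i j s \<in> roots_B I"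
  by (simp add: roots_B_def pair_root_in_D)

lemma regions_eq_empty: "f \<in> F \<Longrightarrow> (\<And>x. x \<in> L \<Longrightarrow> f x = 0) \<Longrightarrow> regions F L = {}"
  by (auto simp: regions_def)

text \<open>The arrangement of type \<open>B\<close> is supersolvable: adding the hyperplanes that involve the
  coordinate \<open>n\<close> one after the other, each of them is cut by the previous ones in an arrangement
  of type \<open>B\<close> again.\<close>

theorem card_regions_B:
  fixes I :: "'i set"
  assumes "finite I" "generic I d L"
  shows "card (regions (roots_B I) L) = count_B (card I) d"
  using assms
proof (induction I arbitrary: d L)
  case empty
  then have "(\<lambda>_. 0) \<in> L" using genericD_lin lin_closed_def by blast
  moreover have "roots_B {} = ({} :: (('i \<Rightarrow> real) \<Rightarrow> real) set)"
    by (simp add: roots_B_def roots_D_def)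
  ultimately have "regions (roots_B {}) L = {{}}" unfolding regions_def by auto
  then show ?case by simp
next
  case (insert n I)
  note g = insert.prems and nI = insert.hyps(2) and fin = insert.hyps(1)
  show ?case
  proof (cases "Suc (card I) \<le> d")
    case True
    have "coord_root n x = 0" if "x \<in> L" for x
    proof -
      have "card (levels (insert n I) x) \<le> card ((\<lambda>i. \<bar>x i\<bar>) ` insert n I)"
        unfolding levels_def using fin by (intro card_mono) auto
      also have "\<dots> \<le> card (insert n I)" using fin by (intro card_image_le) auto
      finally have "card (levels (insert n I) x) \<le> d" using True fin nI by simp
      then show ?thesis using genericD_zero[OF g that] by (simp add: coord_root_def)
    qed
    then have "regions (roots_B (insert n I)) L = {}"
      using regions_eq_empty[OF coord_root_in_B[of n "insert n I"]] by blast
    then show ?thesis using True fin nI by simp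
  next
    case False
    \<comment> \<open>The arrangement after inserting x_n = 0 and the hyperplanes listed in
      \<open>Q\<close>; each hyperplane through coordinate \<open>n\<close> is inserted once, with
      \<open>n\<close> first.\<close>
    define X where "X Q = insert (coord_root n) (roots_B I \<union> (\<lambda>(i, s). pair_root n i s) ` Q)"
      for Q :: "('i \<times> real) set"
    have dI: "d < card (insert n I)" using False fin nI by simp
    have XB: "X Q \<subseteq> roots_B (insert n I)" if "Q \<subseteq> I \<times> {-1, 1}" for Q
    proof -
      have "(\<lambda>(i, s). pair_root n i s) ` Q \<subseteq> roots_B (insert n I)"
      proof
        fix f assume "f \<in> (\<lambda>(i, s). pair_root n i s) ` Q"
        then obtain i s where f: "f = pair_root n i s" "(i, s) \<in> Q" by auto
        show "f \<in> roots_B (insert n I)"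
          unfolding f(1) by (rule pair_root_in_B) (use f(2) that nI in auto)
      qed
      then show ?thesis
        using roots_B_mono[of I "insert n I"] coord_root_in_B[of n "insert n I"]
        unfolding X_def by blast
    qed
    have cut: "card (regions (insert h F) L) = card (regions F L) + card (regions F {x \<in> L. h x = 0})"
      if sub: "insert h F \<subseteq> roots_B (insert n I)" for h F
    proof -
      obtain z where z: "z \<in> L" "h z \<noteq> 0"
        using generic_root_nonzero[OF g _ dI, of h] sub fin by auto
      have "finite F" using sub finite_roots_B[of "insert n I"] fin by (auto intro: finite_subset)
      moreover have "\<And>f. f \<in> F \<Longrightarrow> lin_fun f" using sub lin_fun_roots_B by blast
      moreover have "lin_fun h" using sub lin_fun_roots_B by blast
      ultimately show ?thesis
        using genericD_lin[OF g] z by (rule card_regions_insert)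
    qed
    have restr: "card (regions (roots_B I) {x \<in> L. x n + s * x j = 0}) = count_B (card I) d"
      if "s = 0 \<or> (j \<in> I \<and> s \<in> {-1, 1})" for s j
      by (rule insert.IH) (rule generic_restrict[OF g nI fin that])
    have "card (regions (X Q) L) = count_B (card I) (d - 1) + (1 + card Q) * count_B (card I) d"
      if "finite Q" "Q \<subseteq> I \<times> {-1, 1}" for Q
      using that
    proof (induction Q)
      case empty
      \<comment> \<open>Before x_n = 0 is inserted no functional sees coordinate \<open>n\<close>,
        so the count is that of the projection, with codimension d - 1.\<close>
      have "insert (coord_root n) (roots_B I) \<subseteq> roots_B (insert n I)" using XB[of "{}"] by (simp add: X_def)
      from cut[OF this] show ?case
        using insert.IH[OF generic_project[OF g nI fin]] restr[of 0 n]
        by (simp add: X_def coord_root_def)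
    next
      case (insert q Q)
      obtain i s where q: "q = (i, s)" by (cases q)
      have ii: "i \<in> I" "s \<in> {-1, 1}" "i \<noteq> n" using insert.prems q nI by auto
      define K where "K = {x \<in> L. pair_root n i s x = 0}"
      have K: "x n = - s * x i" if "x \<in> K" for x using that by (simp add: K_def pair_root_def)
      have Xi: "X (insert q Q) = insert (pair_root n i s) (X Q)" by (auto simp: X_def q)
      \<comment> \<open>On x_n = - s x_i the earlier functionals restrict to type B roots on
        \<open>I\<close>: x_n is - s x_i, x_n - s x_i is - 2 s x_i, and x_n + t x_j is - s (x_i - s
        t x_j), using s^2 = 1.\<close>
      have "subordinate K (X Q) (roots_B I)"
      proof (rule subordinateI)
        fix f assume "f \<in> X Q"
        then consider "f = coord_root n" | "f \<in> roots_B I"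
          | j t where "f = pair_root n j t" "(j, t) \<in> Q"
          unfolding X_def by auto
        then show "\<exists>g\<in>roots_B I. \<exists>c. c \<noteq> 0 \<and> (\<forall>x\<in>K. f x = c * g x)"
        proof cases
          case 1
          show ?thesis
            by (rule scaled_memI[of "coord_root i" _ "- s"])
              (use 1 ii K in \<open>auto simp: coord_root_def intro: coord_root_in_B\<close>)
        next
          case 2
          show ?thesis by (rule scaled_memI[of f _ 1]) (use 2 in auto)
        next
          case 3
          have jt: "j \<in> I" "t \<in> {-1, 1}" "(j, t) \<noteq> (i, s)" using 3 insert.prems insert.hyps q by auto
          show ?thesis
          proof (cases "j = i")
            case True
            then have t: "t = - s" using jt ii by auto
            show ?thesis
              by (rule scaled_memI[of "coord_root i" _ "- 2 * s"])
                (use True t 3 ii K in \<open>auto simp: coord_root_def pair_root_def intro: coord_root_in_B\<close>)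
          next
            case False
            show ?thesis
              by (rule scaled_memI[of "pair_root i j (- s * t)" _ "- s"])
                (use False 3 ii jt K in \<open>auto simp: pair_root_def intro!: pair_root_in_B\<close>)
          qed
        qed
      qed
      moreover have "subordinate K (roots_B I) (X Q)"
        by (rule subordinate_subset) (auto simp: X_def)
      ultimately have "card (regions (X Q) K) = card (regions (roots_B I) K)"
        by (rule card_regions_cong)
      also have "\<dots> = count_B (card I) d"
        using restr[of s i] ii by (simp add: K_def pair_root_def)
      finally have "card (regions (X (insert q Q)) L) = card (regions (X Q) L) + count_B (card I) d"
        using cut[of "pair_root n i s" "X Q"] XB[OF insert.prems] unfolding Xi K_def by simp
      then show ?case using insert.IH insert.prems insert.hyps by simp
    qed
    from this[of "I \<times> {-1, 1}"]
    have "card (regions (X (I \<times> {-1, 1})) L) = count_B (card I) (d - 1) + (2 * card I + 1) * count_B (card I) d"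
      using fin by (simp add: card_cartesian_product)
    moreover have "card (regions (roots_B (insert n I)) L) = card (regions (X (I \<times> {-1, 1})) L)"
    proof (rule card_regions_cong)
      show "subordinate L (X (I \<times> {-1, 1})) (roots_B (insert n I))"
        by (rule subordinate_subset) (rule XB, simp)
      have Xp: "pair_root n i s \<in> X (I \<times> {-1, 1})" if "i \<in> I" "s \<in> {-1, 1}" for i s
        using that unfolding X_def by force
      have XI: "roots_B I \<subseteq> X Q" "coord_root n \<in> X Q" for Q unfolding X_def by auto
      show "subordinate L (roots_B (insert n I)) (X (I \<times> {-1, 1}))"
      proof (rule subordinateI)
        fix f assume "f \<in> roots_B (insert n I)"
        then show "\<exists>g\<in>X (I \<times> {-1, 1}). \<exists>c. c \<noteq> 0 \<and> (\<forall>x\<in>L. f x = c * g x)"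
        proof (cases rule: roots_BE)
          case (coord i)
          then have "f \<in> X (I \<times> {-1, 1})"
            using XI coord_root_in_B[of i I] by blast
          then show ?thesis by (rule scaled_memI[of _ _ 1]) auto
        next
          case (pair i j s)
          show ?thesis
          proof (cases "j = n")
            case True
            show ?thesis
              by (rule scaled_memI[of "pair_root n i s" _ s])
                (use True pair in \<open>auto simp: pair_root_def intro!: Xp\<close>)
          next
            case False
            have "f \<in> X (I \<times> {-1, 1})"
            proof (cases "i = n")
              case True
              then show ?thesis using Xp pair False by auto
            next
              case inn: False
              have "f \<in> roots_B I" unfolding pair(1)
                by (rule pair_root_in_B) (use pair inn False in auto)
              then show ?thesis using XI by blast
            qed
            then show ?thesis by (rule scaled_memI[of _ _ 1]) auto
          qed
        qed
      qed
    qed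
    ultimately show ?thesis using False fin nI by simp
  qed
qed

text \<open>Inserting the coordinate hyperplanes into type D leads to type B. On x_i = 0 the roots
  x_j + s x_i become coordinate roots, so each inserted hyperplane carries a full type B arrangement
  in one coordinate less, whichever coordinate hyperplanes came before.\<close>

theorem card_regions_D:
  fixes I :: "'i set"
  assumes fin: "finite I" and g: "generic I d L" and dI: "d < card I"
  shows "count_B (card I) d = card (regions (roots_D I) L) + card I * count_B (card I - 1) d"
proof -
  define X where "X Q = roots_D I \<union> coord_root ` Q" for Q
  have "card (regions (X Q) L) = card (regions (roots_D I) L) + card Q * count_B (card I - 1) d"
    if "finite Q" "Q \<subseteq> I" for Q
    using that
  proof (induction Q)
    case empty
    then show ?case by (simp add: X_def)
  next
    case (insert i Q)
    have iI: "i \<in> I" "insert i (I - {i}) = I" using insert.prems by auto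
    define K where "K = {x \<in> L. coord_root i x = 0}"
    have XB: "X Q \<subseteq> roots_B I" using insert.prems by (auto simp: X_def roots_B_def)
    obtain z where z: "z \<in> L" "coord_root i z \<noteq> 0"
      using generic_root_nonzero[OF g fin dI coord_root_in_B[OF iI(1)]] by blast
    have finX: "finite (X Q)" using XB finite_roots_B[OF fin] by (rule finite_subset)
    have linX: "\<And>f. f \<in> X Q \<Longrightarrow> lin_fun f" using XB lin_fun_roots_B by blast
    have "card (regions (insert (coord_root i) (X Q)) L) = card (regions (X Q) L) + card (regions (X Q) K)"
      unfolding K_def using finX linX lin_fun_coord genericD_lin[OF g] z by (rule card_regions_insert)
    moreover have "card (regions (X Q) K) = card (regions (roots_B (I - {i})) K)"
    proof (rule card_regions_cong)
      show "subordinate K (X Q) (roots_B (I - {i}))"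
      proof (rule subordinateI)
        fix f assume "f \<in> X Q"
        then consider j where "f = coord_root j" "j \<in> Q" | "f \<in> roots_D I" unfolding X_def by blast
        then show "\<exists>g\<in>roots_B (I - {i}). \<exists>c. c \<noteq> 0 \<and> (\<forall>x\<in>K. f x = c * g x)"
        proof cases
          case 1
          show ?thesis
            by (rule scaled_memI[of f _ 1]) (use 1 insert in \<open>auto intro!: coord_root_in_B\<close>)
        next
          case 2
          then obtain j k s where f: "f = pair_root j k s" "j \<in> I" "k \<in> I" "j \<noteq> k" "s \<in> {-1, 1}"
            by (rule roots_DE)
          show ?thesis
          proof (cases "j = i")
            case True
            show ?thesis
              by (rule scaled_memI[of "coord_root k" _ s])
                (use f True in \<open>auto simp: K_def coord_root_def pair_root_def intro!: coord_root_in_B\<close>)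
          next
            case ji: False
            show ?thesis
            proof (cases "k = i")
              case True
              show ?thesis
                by (rule scaled_memI[of "coord_root j" _ 1])
                  (use f True ji in \<open>auto simp: K_def coord_root_def pair_root_def intro!: coord_root_in_B\<close>)
            next
              case False
              show ?thesis
                by (rule scaled_memI[of f _ 1]) (use f ji False in \<open>auto intro!: pair_root_in_B\<close>)
            qed
          qed
        qed
      qed
      show "subordinate K (roots_B (I - {i})) (X Q)"
      proof (rule subordinateI)
        fix f assume "f \<in> roots_B (I - {i})"
        then show "\<exists>g\<in>X Q. \<exists>c. c \<noteq> 0 \<and> (\<forall>x\<in>K. f x = c * g x)"
        proof (cases rule: roots_BE)
          case (coord j)
          have "pair_root j i 1 \<in> X Q"
            unfolding X_def using coord iI by (auto intro!: pair_root_in_D)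
          then show ?thesis
            by (rule scaled_memI[of _ _ 1]) (use coord in \<open>auto simp: K_def coord_root_def pair_root_def\<close>)
        next
          case (pair j k s)
          have "f \<in> X Q"
            unfolding X_def pair(1) using pair iI by (auto intro!: pair_root_in_D)
          then show ?thesis by (rule scaled_memI[of _ _ 1]) auto
        qed
      qed
    qed
    moreover have "card (regions (roots_B (I - {i})) K) = count_B (card I - 1) d"
    proof -
      have "generic (I - {i}) d {x \<in> L. x i + 0 * x i = 0}"
        by (rule generic_restrict) (use g iI fin in auto)
      then have "generic (I - {i}) d K" by (simp add: K_def coord_root_def)
      then show ?thesis using card_regions_B[of "I - {i}" d K] fin iI by simp
    qed
    moreover have "X (insert i Q) = insert (coord_root i) (X Q)" by (auto simp: X_def)
    ultimately show ?case using insert by simp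
  qed
  from this[OF fin subset_refl] have
    "card (regions (roots_B I) L) = card (regions (roots_D I) L) + card I * count_B (card I - 1) d"
    by (simp add: X_def roots_B_def Un_commute)
  then show ?thesis using card_regions_B[OF fin g] by simp
qed

section \<open>Closed form of the recursion\<close>

text \<open>Every second coefficient from index \<open>k\<close> on; the bound
  \<open>degree p\<close> is generous, as all later coefficients vanish.\<close>

definition alt_sum :: "int poly \<Rightarrow> nat \<Rightarrow> int" where
  "alt_sum p k = (\<Sum>j\<le>degree p. coeff p (k + 2 * j))"

lemma alt_sum_eq:
  assumes "degree p \<le> N"
  shows "alt_sum p k = (\<Sum>j\<le>N. coeff p (k + 2 * j))"
  unfolding alt_sum_def
  by (rule sum.mono_neutral_left) (use assms in \<open>auto intro!: coeff_eq_0\<close>)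

lemma degree_mult_linear_le: "degree (p * [:a, 1:]) \<le> Suc (degree p)"
  by (rule order_trans[OF degree_mult_le]) simp

lemma coeff_mult_linear_Suc: "coeff (p * [:a, 1:]) (Suc m) = a * coeff p (Suc m) + coeff p m" for a :: int
  by (simp add: mult.commute[of p] mult_pCons_left)

lemma alt_sum_mult_linear:
  "alt_sum (p * [:a, 1:]) (Suc k) = a * alt_sum p (Suc k) + alt_sum p k"
  unfolding alt_sum_eq[OF degree_mult_linear_le] alt_sum_eq[of p "Suc (degree p)", OF le_SucI[OF order_refl]]
  by (simp add: coeff_mult_linear_Suc sum.distrib sum_distrib_left del: sum.atMost_Suc)

text \<open>The constant term has no predecessor, so shifting the even coefficients by one brings in
  the odd ones, starting at index 1.\<close>

lemma alt_sum_mult_linear_0: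
  "alt_sum (p * [:a, 1:]) 0 = a * alt_sum p 0 + alt_sum p 1"
proof -
  have "alt_sum (p * [:a, 1:]) 0 = (\<Sum>j\<le>Suc (degree p). coeff (p * [:a, 1:]) (2 * j))"
    using alt_sum_eq[OF degree_mult_linear_le, of p a 0] by (simp only: add_0)
  also have "\<dots> = coeff (p * [:a, 1:]) 0 + (\<Sum>j\<le>degree p. coeff (p * [:a, 1:]) (Suc (Suc (2 * j))))"
    by (subst sum.atMost_Suc_shift) (simp only: mult_Suc_right mult_0_right numeral_2_eq_2 add_Suc add_0)
  also have "\<dots> = a * (coeff p 0 + (\<Sum>j\<le>degree p. coeff p (2 * Suc j))) + (\<Sum>j\<le>degree p. coeff p (1 + 2 * j))"
    unfolding coeff_mult_linear_Suc sum.distrib sum_distrib_left[symmetric] by (simp add: distrib_left)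
  also have "coeff p 0 + (\<Sum>j\<le>degree p. coeff p (2 * Suc j)) = (\<Sum>j\<le>Suc (degree p). coeff p (0 + 2 * j))"
    by (subst sum.atMost_Suc_shift) simp
  also have "\<dots> = alt_sum p 0" by (subst alt_sum_eq[of p "Suc (degree p)"]) auto
  finally show ?thesis by (simp add: alt_sum_def)
qed

text \<open>Up to signs the characteristic polynomial of the type B arrangement.\<close>

definition Bpoly :: "nat \<Rightarrow> int poly" where
  "Bpoly n = (\<Prod>i\<in>{1..n}. [:int (2 * i - 1), 1:])"

lemma Bpoly_Suc: "Bpoly (Suc n) = Bpoly n * [:int (2 * n + 1), 1:]"
  by (simp add: Bpoly_def prod.nat_ivl_Suc')

lemma degree_Bpoly_le: "degree (Bpoly n) \<le> n"
proof (induction n)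
  case 0
  then show ?case by (simp add: Bpoly_def)
next
  case (Suc n)
  then show ?case using degree_mult_linear_le[of "Bpoly n" "int (2 * n + 1)"] by (simp only: Bpoly_Suc)
qed

lemma Dpoly_eq: "Dpoly (Suc n) = Bpoly n * [:int n, 1:]"
  by (simp add: Dpoly_def Bpoly_def)

lemma degree_Dpoly_le: "degree (Dpoly (Suc n)) \<le> Suc n"
  using degree_mult_linear_le[of "Bpoly n" "int n"] degree_Bpoly_le[of n] by (simp add: Dpoly_eq)

lemma Bpoly_1: "Bpoly (Suc 0) = [:1, 1:]"
  by (simp add: Bpoly_def)

text \<open>The factor t + 1 gives a root at -1, which balances even and odd coefficients. This is
  what reconciles the two recursions at \<open>d = 0\<close>, where \<open>d - 1\<close> is again
  0.\<close>

lemma alt_sum_Bpoly_0: "alt_sum (Bpoly (Suc n)) 0 = alt_sum (Bpoly (Suc n)) 1"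
proof (induction n)
  case 0
  then show ?case by (simp add: Bpoly_1 alt_sum_def numeral_2_eq_2)
next
  case (Suc n)
  have "alt_sum (Bpoly (Suc (Suc n))) 0 = int (2 * Suc n + 1) * alt_sum (Bpoly (Suc n)) 0 + alt_sum (Bpoly (Suc n)) 1"
    unfolding Bpoly_Suc[of "Suc n"] by (rule alt_sum_mult_linear_0)
  moreover have "alt_sum (Bpoly (Suc (Suc n))) 1 = int (2 * Suc n + 1) * alt_sum (Bpoly (Suc n)) 1 + alt_sum (Bpoly (Suc n)) 0"
    unfolding Bpoly_Suc[of "Suc n"] One_nat_def by (rule alt_sum_mult_linear)
  ultimately show ?case using Suc by simp
qed

lemma alt_sum_eq_0: "degree p < k \<Longrightarrow> alt_sum p k = 0"
  by (simp add: alt_sum_def coeff_eq_0)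

text \<open>Multiplication by t + 2n + 1 reproduces the recursion of \<open>count_B\<close>. The
  factor 2 comes from the line, which 0 cuts into two half-lines. The index starts at 1 because the
  empty arrangement has a single region, an odd number.\<close>

lemma count_B_eq_alt_sum: "int (count_B (Suc n) d) = 2 * alt_sum (Bpoly (Suc n)) (Suc d)"
proof (induction n arbitrary: d)
  case 0
  show ?case
    by (cases d) (simp_all add: Bpoly_1 alt_sum_def numeral_2_eq_2)
next
  case (Suc n)
  note IH = Suc.IH
  have rec: "alt_sum (Bpoly (Suc (Suc n))) (Suc d) =
      int (2 * Suc n + 1) * alt_sum (Bpoly (Suc n)) (Suc d) + alt_sum (Bpoly (Suc n)) d"
    unfolding Bpoly_Suc[of "Suc n"] by (rule alt_sum_mult_linear)
  show ?case
  proof (cases "Suc (Suc n) \<le> d")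
    case True
    then have "degree (Bpoly (Suc (Suc n))) < Suc d" using degree_Bpoly_le[of "Suc (Suc n)"] by linarith
    then show ?thesis using True alt_sum_eq_0 by simp
  next
    case False
    then have c: "int (count_B (Suc (Suc n)) d) =
        int (count_B (Suc n) (d - 1)) + int (2 * Suc n + 1) * int (count_B (Suc n) d)"
      by (subst count_B.simps) (simp add: algebra_simps del: count_B.simps)
    show ?thesis
    proof (cases d)
      case 0
      then show ?thesis
        unfolding c rec IH using alt_sum_Bpoly_0[of n] by (simp add: algebra_simps)
    next
      case (Suc e)
      then show ?thesis unfolding c rec IH by (simp add: algebra_simps)
    qed
  qed
qed

text \<open>Since 2n - 1 = (n - 1) + n, \<open>Bpoly n\<close> is \<open>Dpoly n\<close> plus n
  times \<open>Bpoly (n - 1)\<close>. Comparison with \<open>card_regions_D\<close> isolates the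
  type D count.\<close>

lemma count_B_diff:
  assumes "n \<ge> 2"
  shows "int (count_B n d) = 2 * (\<Sum>j\<le>n. Dcoef n (d + 1 + 2 * j)) + int n * int (count_B (n - 1) d)"
proof -
  obtain m where n: "n = Suc (Suc m)" by (rule that[of "n - 2"]) (use assms in simp)
  have "(\<Sum>j\<le>n. Dcoef n (d + 1 + 2 * j)) = alt_sum (Dpoly n) (Suc d)"
    using alt_sum_eq[OF degree_Dpoly_le, of "Suc m" "Suc d"] by (simp add: n Dcoef_def)
  also have "\<dots> = int (Suc m) * alt_sum (Bpoly (Suc m)) (Suc d) + alt_sum (Bpoly (Suc m)) d"
    unfolding n Dpoly_eq by (rule alt_sum_mult_linear)
  finally have D: "(\<Sum>j\<le>n. Dcoef n (d + 1 + 2 * j)) =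
      int (Suc m) * alt_sum (Bpoly (Suc m)) (Suc d) + alt_sum (Bpoly (Suc m)) d" .
  have "alt_sum (Bpoly n) (Suc d) =
      int (2 * Suc m + 1) * alt_sum (Bpoly (Suc m)) (Suc d) + alt_sum (Bpoly (Suc m)) d"
    unfolding n Bpoly_Suc[of "Suc m"] by (rule alt_sum_mult_linear)
  then show ?thesis
    unfolding D using count_B_eq_alt_sum[of "Suc m" d] count_B_eq_alt_sum[of m d]
    by (simp add: n algebra_simps del: count_B.simps)
qed

lemma Dcoef_sum_eq_0:
  assumes "n \<ge> 1" "n \<le> d"
  shows "(\<Sum>j\<le>n. Dcoef n (d + 1 + 2 * j)) = 0"
proof (rule sum.neutral, rule ballI)
  fix j
  obtain m where n: "n = Suc m" using assms by (cases n) auto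
  show "Dcoef n (d + 1 + 2 * j) = 0"
    unfolding Dcoef_def using degree_Dpoly_le[of m] assms by (intro coeff_eq_0) (simp add: n)
qed

text \<open>The order of the Weyl group of type B: at \<open>d = 0\<close> both terms of the
  recursion coincide and give the factor 2n + 2.\<close>

lemma count_B_0: "count_B n 0 = 2 ^ n * fact n"
  by (induction n) (simp_all add: algebra_simps)

section \<open>Weyl chambers of type D\<close>

lemma ex_sorting_permutation:
  fixes f :: "nat \<Rightarrow> real"
  obtains \<sigma> where "\<sigma> permutes {1..n}" "\<And>i j. 1 \<le> i \<Longrightarrow> i \<le> j \<Longrightarrow> j \<le> n \<Longrightarrow> f (\<sigma> j) \<le> f (\<sigma> i)"
proof -
  define xs where "xs = sort_key (\<lambda>i. - f i) [1..<Suc n]"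
  have xs: "length xs = n" "set xs = {1..n}" "distinct xs"
    by (auto simp: xs_def simp del: upt_Suc)
  have sorted: "sorted (map (\<lambda>i. - f i) xs)" by (simp add: xs_def)
  define \<sigma> where "\<sigma> i = (if i \<in> {1..n} then xs ! (i - 1) else i)" for i
  have "\<sigma> permutes {1..n}"
  proof (rule bij_imp_permutes)
    have "inj_on \<sigma> {1..n}"
    proof (rule inj_onI)
      fix i j assume ij: "i \<in> {1..n}" "j \<in> {1..n}" "\<sigma> i = \<sigma> j"
      then have "i - 1 = j - 1"
        using nth_eq_iff_index_eq[OF xs(3), of "i - 1" "j - 1"] xs(1) by (auto simp: \<sigma>_def)
      then show "i = j" using ij by auto
    qed
    moreover have "\<sigma> ` {1..n} \<subseteq> {1..n}"
    proof
      fix k assume "k \<in> \<sigma> ` {1..n}"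
      then obtain i where i: "i \<in> {1..n}" "k = xs ! (i - 1)" by (auto simp: \<sigma>_def)
      then have "i - 1 < length xs" using xs(1) by auto
      then show "k \<in> {1..n}" using i nth_mem xs(2) by blast
    qed
    ultimately show "bij_betw \<sigma> {1..n} {1..n}"
      by (simp add: bij_betw_def endo_inj_surj)
  qed (auto simp: \<sigma>_def)
  moreover have "f (\<sigma> j) \<le> f (\<sigma> i)" if "1 \<le> i" "i \<le> j" "j \<le> n" for i j
  proof -
    have l: "i - 1 \<le> j - 1" "i - 1 < length xs" "j - 1 < length xs" using that xs(1) by auto
    have "map (\<lambda>i. - f i) xs ! (i - 1) \<le> map (\<lambda>i. - f i) xs ! (j - 1)"
      using l by (intro sorted_nth_mono[OF sorted]) auto
    then have "f (xs ! (j - 1)) \<le> f (xs ! (i - 1))" using l by simp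
    moreover have "i \<in> {1..n}" "j \<in> {1..n}" using that by auto
    ultimately show ?thesis unfolding \<sigma>_def by simp
  qed
  ultimately show thesis by (rule that)
qed

text \<open>The Weyl group of type D. Extensional sign functions make each element occur exactly
  once, so that cardinalities are meaningful.\<close>

definition even_signed_perms :: "nat \<Rightarrow> ((nat \<Rightarrow> nat) \<times> (nat \<Rightarrow> real)) set" where
  "even_signed_perms n = {(\<sigma>, \<epsilon>). \<sigma> permutes {1..n} \<and> \<epsilon> \<in> {1..n} \<rightarrow>\<^sub>E {-1, 1} \<and> (\<Prod>i\<in>{1..n}. \<epsilon> i) = 1}"

text \<open>Kept polymorphic so that the same element acts on coefficient vectors and on the steps
  of the walk.\<close>

definition signed_act :: "(nat \<Rightarrow> nat) \<times> (nat \<Rightarrow> real) \<Rightarrow> (nat \<Rightarrow> 'b) \<Rightarrow> nat \<Rightarrow> 'b::real_vector" where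
  "signed_act g x i = snd g i *\<^sub>R x (fst g i)"

text \<open>For n at least 2 this is u_1 > ... > u_(n-1) > |u_n|, written through its n walls, the
  simple roots of type D.\<close>

definition open_chamber :: "nat \<Rightarrow> (nat \<Rightarrow> real) \<Rightarrow> bool" where
  "open_chamber n u \<longleftrightarrow> (\<forall>i\<in>{1..<n}. u (Suc i) < u i) \<and> 0 < u (n - 1) + u n"

definition closed_chamber :: "nat \<Rightarrow> (nat \<Rightarrow> real) \<Rightarrow> bool" where
  "closed_chamber n u \<longleftrightarrow> (\<forall>i\<in>{1..<n}. u (Suc i) \<le> u i) \<and> 0 \<le> u (n - 1) + u n"

lemma finite_even_signed_perms: "finite (even_signed_perms n)"
  unfolding even_signed_perms_def
  by (rule finite_subset[of _ "{\<sigma>. \<sigma> permutes {1..n}} \<times> ({1..n} \<rightarrow>\<^sub>E {-1, 1})"])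
    (auto intro!: finite_permutations finite_cartesian_product finite_PiE)

lemma even_signed_permsD:
  assumes "g \<in> even_signed_perms n"
  shows "fst g permutes {1..n}" "\<And>i. i \<in> {1..n} \<Longrightarrow> snd g i \<in> {-1, 1}" "(\<Prod>i\<in>{1..n}. snd g i) = 1"
    "\<And>i. i \<notin> {1..n} \<Longrightarrow> snd g i = undefined"
  using assms by (auto simp: even_signed_perms_def PiE_def Pi_def extensional_def)

lemma open_chamber_less:
  assumes u: "open_chamber n u" and ij: "1 \<le> i" "i < j" "j \<le> n"
  shows "\<bar>u j\<bar> < u i"
proof -
  have dec: "u (i + k) \<le> u i" if "1 \<le> i" "i + k \<le> n" for i k
    using that
  proof (induction k)
    case (Suc k)
    have "u (Suc (i + k)) < u (i + k)" using Suc.prems u by (simp add: open_chamber_def)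
    then show ?case using Suc by simp
  qed simp
  have S: "u (Suc i) < u i" if "1 \<le> i" "i < n" for i
    using that u by (simp add: open_chamber_def)
  have "u j \<le> u (Suc i)" using dec[of "Suc i" "j - Suc i"] ij by simp
  then have 1: "u j < u i" using S[of i] ij by simp
  have "u n \<le> u j" using dec[of j "n - j"] ij by simp
  moreover have "u (n - 1) \<le> u i" using dec[of i "n - 1 - i"] ij by simp
  ultimately have "0 < u j + u i" using u by (simp add: open_chamber_def)
  then show ?thesis using 1 by linarith
qed

lemma permutes_image_ex:
  assumes "\<sigma> permutes {1..n}" "a \<in> {1..n}"
  obtains i where "i \<in> {1..n}" "\<sigma> i = a"
  using assms by (metis imageE permutes_image)

text \<open>Of the two coordinates in a root, the one placed earlier by \<open>g\<close> dominates
  the other in absolute value. Hence \<open>c\<close> is the sign with which that coordinate enters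
  the root.\<close>

lemma chamber_root_sign:
  assumes g: "g \<in> even_signed_perms n" and f: "f \<in> roots_D {1..n}"
  shows "\<exists>c. \<forall>z. open_chamber n (signed_act g z) \<longrightarrow> 0 < c * f z"
proof -
  note gD = even_signed_permsD[OF g]
  obtain a b s where f: "f = pair_root a b s" "a \<in> {1..n}" "b \<in> {1..n}" "a \<noteq> b" "s \<in> {-1, 1}"
    using f by (rule roots_DE)
  obtain i where i: "i \<in> {1..n}" "fst g i = a" using permutes_image_ex[OF gD(1) f(2)] by blast
  obtain j where j: "j \<in> {1..n}" "fst g j = b" using permutes_image_ex[OF gD(1) f(3)] by blast
  have zi: "z a = snd g i * signed_act g z i" for z :: "nat \<Rightarrow> real"
    using gD(2)[OF i(1)] i(2) by (auto simp: signed_act_def)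
  have zj: "z b = snd g j * signed_act g z j" for z :: "nat \<Rightarrow> real"
    using gD(2)[OF j(1)] j(2) by (auto simp: signed_act_def)
  consider "i < j" | "j < i" using i j f by fastforce
  then show ?thesis
  proof cases
    case 1
    show ?thesis
    proof (intro exI[of _ "snd g i"] allI impI)
      fix z assume "open_chamber n (signed_act g z)"
      then have "\<bar>signed_act g z j\<bar> < signed_act g z i"
        using open_chamber_less[of n "signed_act g z" i j] 1 i j by auto
      then show "0 < snd g i * f z"
        unfolding f(1) pair_root_def zi zj
        using gD(2)[OF i(1)] gD(2)[OF j(1)] f(5) by auto
    qed
  next
    case 2
    show ?thesis
    proof (intro exI[of _ "s * snd g j"] allI impI)
      fix z assume "open_chamber n (signed_act g z)"
      then have "\<bar>signed_act g z i\<bar> < signed_act g z j"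
        using open_chamber_less[of n "signed_act g z" j i] 2 i j by auto
      then show "0 < s * snd g j * f z"
        unfolding f(1) pair_root_def zi zj
        using gD(2)[OF i(1)] gD(2)[OF j(1)] f(5) by auto
    qed
  qed
qed

text \<open>Each wall of the chamber, pulled back by \<open>g\<close>, is a root of type D up to
  sign, so membership is decided by the sign pattern.\<close>

lemma chamber_same_signs:
  assumes n: "n \<ge> 2" and g: "g \<in> even_signed_perms n" and z: "open_chamber n (signed_act g z)"
    and nv: "\<forall>f\<in>roots_D {1..n}. f w \<noteq> 0"
    and eq: "{f \<in> roots_D {1..n}. f w > 0} = {f \<in> roots_D {1..n}. f z > 0}"
  shows "open_chamber n (signed_act g w)"
proof -
  note gD = even_signed_permsD[OF g]
  have key: "0 < signed_act g w i + t * signed_act g w j"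
    if ij: "i \<in> {1..n}" "j \<in> {1..n}" "i \<noteq> j" "t \<in> {-1, 1}"
      and pos: "0 < signed_act g z i + t * signed_act g z j" for i j t
  proof -
    define f where "f = pair_root (fst g i) (fst g j) (t * snd g i * snd g j)"
    have f: "snd g i * f x = signed_act g x i + t * signed_act g x j" for x
      using gD(2)[OF ij(1)] by (auto simp: f_def pair_root_def signed_act_def)
    have fD: "f \<in> roots_D {1..n}"
      unfolding f_def
    proof (rule pair_root_in_D)
      show "fst g i \<in> {1..n}" "fst g j \<in> {1..n}" using gD(1) ij by (simp_all only: permutes_in_image)
      show "fst g i \<noteq> fst g j" using permutes_inj[OF gD(1)] ij(3) by (simp add: inj_eq)
      show "t * snd g i * snd g j \<in> {-1, 1}" using gD(2)[OF ij(1)] gD(2)[OF ij(2)] ij(4) by auto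
    qed
    have "f w \<noteq> 0" using nv fD by blast
    moreover have "f w > 0 \<longleftrightarrow> f z > 0" using eq fD by blast
    moreover have "0 < snd g i * f z" using pos f by simp
    ultimately have "0 < snd g i * f w" using gD(2)[OF ij(1)] by auto
    then show ?thesis using f by simp
  qed
  show ?thesis
    unfolding open_chamber_def
  proof (intro conjI ballI)
    fix i assume "i \<in> {1..<n}"
    then show "signed_act g w (Suc i) < signed_act g w i"
      using key[of i "Suc i" "-1"] z by (simp add: open_chamber_def)
  next
    show "0 < signed_act g w (n - 1) + signed_act g w n"
      using key[of "n - 1" n 1] z n by (simp add: open_chamber_def)
  qed
qed

text \<open>The position of a coordinate is one more than the number of coordinates of larger
  absolute value, which fixes the permutation. Positivity fixes the first n - 1 signs and the
  product condition the last.\<close>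

lemma chamber_unique:
  assumes n: "n \<ge> 2" and g: "g \<in> even_signed_perms n" "open_chamber n (signed_act g z)"
    and h: "h \<in> even_signed_perms n" "open_chamber n (signed_act h z)"
  shows "g = h"
proof -
  have rank: "card {j \<in> {1..n}. \<bar>z a\<bar> < \<bar>z j\<bar>} = i - 1"
    if g: "g \<in> even_signed_perms n" "open_chamber n (signed_act g z)" and i: "i \<in> {1..n}" "fst g i = a"
    for g i a
  proof -
    note gD = even_signed_permsD[OF g(1)]
    have ab: "\<bar>signed_act g z k\<bar> = \<bar>z (fst g k)\<bar>" if "k \<in> {1..n}" for k
      using gD(2)[OF that] by (auto simp: signed_act_def)
    have less: "\<bar>z (fst g l)\<bar> < \<bar>z (fst g k)\<bar>" if "k \<in> {1..n}" "l \<in> {1..n}" "k < l" for k l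
      using open_chamber_less[OF g(2), of k l] that ab[of k] ab[of l] by auto
    have "{j \<in> {1..n}. \<bar>z a\<bar> < \<bar>z j\<bar>} = fst g ` {1..<i}"
    proof (intro equalityI subsetI)
      fix j assume j: "j \<in> {j \<in> {1..n}. \<bar>z a\<bar> < \<bar>z j\<bar>}"
      then obtain k where k: "k \<in> {1..n}" "fst g k = j" using permutes_image_ex[OF gD(1), of j] by blast
      have "k < i"
      proof (rule ccontr)
        assume "\<not> k < i"
        then consider "k = i" | "i < k" by linarith
        then show False using less[of i k] i k j by cases auto
      qed
      then show "j \<in> fst g ` {1..<i}" using k by auto
    next
      fix j assume "j \<in> fst g ` {1..<i}"
      then obtain k where k: "k \<in> {1..<i}" "j = fst g k" by blast
      then show "j \<in> {j \<in> {1..n}. \<bar>z a\<bar> < \<bar>z j\<bar>}"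
        using less[of k i] i permutes_in_image[OF gD(1), of k] by auto
    qed
    moreover have "inj_on (fst g) {1..<i}" using permutes_inj_on[OF gD(1)] .
    ultimately show ?thesis by (simp add: card_image)
  qed
  note gD = even_signed_permsD[OF g(1)] and hD = even_signed_permsD[OF h(1)]
  have fst: "fst g i = fst h i" for i
  proof (cases "i \<in> {1..n}")
    case True
    obtain k where k: "k \<in> {1..n}" "fst h k = fst g i"
      using permutes_image_ex[OF hD(1), of "fst g i"] permutes_in_image[OF gD(1), of i] True by blast
    have "i - 1 = k - 1" using rank[OF g True refl] rank[OF h k] by simp
    then have "i = k" using True k by auto
    then show ?thesis using k by simp
  next
    case False
    then show ?thesis using permutes_not_in[OF gD(1)] permutes_not_in[OF hD(1)] by simp
  qed
  have sndl: "snd g i = snd h i" if "i \<in> {1..<n}" for i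
  proof -
    have i: "i \<in> {1..n}" using that by auto
    have "0 < signed_act g z i" "0 < signed_act h z i"
      using open_chamber_less[OF g(2), of i n] open_chamber_less[OF h(2), of i n] that by auto
    then have "0 < snd g i * z (fst g i)" "0 < snd h i * z (fst g i)"
      using fst by (auto simp: signed_act_def)
    then show ?thesis using gD(2)[OF i] hD(2)[OF i] by auto
  qed
  have I: "{1..n} = insert n {1..<n}" using n by auto
  have "snd g n = snd h n"
  proof -
    have "snd g n * (\<Prod>i\<in>{1..<n}. snd g i) = 1" "snd h n * (\<Prod>i\<in>{1..<n}. snd h i) = 1"
      using gD(3) hD(3) unfolding I by simp_all
    moreover have "(\<Prod>i\<in>{1..<n}. snd g i) = (\<Prod>i\<in>{1..<n}. snd h i)"
      using sndl by (intro prod.cong) auto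
    ultimately show ?thesis by (metis mult.right_neutral mult.left_commute mult.commute)
  qed
  then have "snd g i = snd h i" for i
    using sndl I gD(4)[of i] hD(4)[of i] by (cases "i \<in> {1..n}") auto
  then show ?thesis using fst by (intro prod_eqI ext) auto
qed

lemma chamber_exists:
  assumes n: "n \<ge> 2" and nv: "\<forall>f\<in>roots_D {1..n}. f z \<noteq> 0"
  shows "\<exists>g\<in>even_signed_perms n. open_chamber n (signed_act g z)"
proof -
  obtain \<sigma> where \<sigma>: "\<sigma> permutes {1..n}"
      "\<And>i j. 1 \<le> i \<Longrightarrow> i \<le> j \<Longrightarrow> j \<le> n \<Longrightarrow> \<bar>z (\<sigma> j)\<bar> \<le> \<bar>z (\<sigma> i)\<bar>"
    using ex_sorting_permutation[of n "\<lambda>i. \<bar>z i\<bar>"] by blast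
  have ne: "\<bar>z a\<bar> \<noteq> \<bar>z b\<bar>" if "a \<in> {1..n}" "b \<in> {1..n}" "a \<noteq> b" for a b
  proof -
    have "pair_root a b (-1) z \<noteq> 0" "pair_root a b 1 z \<noteq> 0"
      using nv that by (auto intro!: pair_root_in_D)
    then show ?thesis by (auto simp: pair_root_def abs_if)
  qed
  have less: "\<bar>z (\<sigma> j)\<bar> < \<bar>z (\<sigma> i)\<bar>" if "1 \<le> i" "i < j" "j \<le> n" for i j
  proof -
    have "\<sigma> i \<noteq> \<sigma> j" using permutes_inj[OF \<sigma>(1)] that by (simp add: inj_eq)
    then have "\<bar>z (\<sigma> j)\<bar> \<noteq> \<bar>z (\<sigma> i)\<bar>"
      using ne[of "\<sigma> j" "\<sigma> i"] permutes_in_image[OF \<sigma>(1)] that by auto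
    then show ?thesis using \<sigma>(2)[of i j] that by simp
  qed
  define e where "e i = (if z (\<sigma> i) > 0 then 1 else -1 :: real)" for i
  \<comment> \<open>The chamber bounds only the absolute value of the last entry, so the last sign
    is free to make the total product P * P = 1.\<close>
  define P where "P = (\<Prod>i\<in>{1..<n}. e i)"
  define \<epsilon> where "\<epsilon> = (\<lambda>i\<in>{1..n}. if i = n then P else e i)"
  have I: "{1..n} = insert n {1..<n}" using n by auto
  have "P * P = 1" unfolding P_def prod.distrib[symmetric] by (intro prod.neutral) (auto simp: e_def)
  then have P: "P \<in> {-1, 1}" by (simp add: square_eq_1_iff disj_commute)
  have "(\<Prod>i\<in>{1..n}. \<epsilon> i) = P * (\<Prod>i\<in>{1..<n}. \<epsilon> i)" unfolding I using n by (simp add: \<epsilon>_def)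
  also have "(\<Prod>i\<in>{1..<n}. \<epsilon> i) = P" unfolding P_def by (rule prod.cong) (auto simp: \<epsilon>_def)
  finally have "(\<Prod>i\<in>{1..n}. \<epsilon> i) = 1" using \<open>P * P = 1\<close> by simp
  moreover have "\<epsilon> \<in> {1..n} \<rightarrow>\<^sub>E {-1, 1}" using P by (auto simp: \<epsilon>_def e_def)
  ultimately have g: "(\<sigma>, \<epsilon>) \<in> even_signed_perms n" using \<sigma>(1) by (simp add: even_signed_perms_def)
  have ul: "signed_act (\<sigma>, \<epsilon>) z i = \<bar>z (\<sigma> i)\<bar>" if "i \<in> {1..<n}" for i
    using that less[of i n] by (auto simp: signed_act_def \<epsilon>_def e_def)
  have un: "\<bar>signed_act (\<sigma>, \<epsilon>) z n\<bar> = \<bar>z (\<sigma> n)\<bar>"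
    using P n by (auto simp: signed_act_def \<epsilon>_def)
  have "open_chamber n (signed_act (\<sigma>, \<epsilon>) z)"
    unfolding open_chamber_def
  proof (intro conjI ballI)
    fix i assume i: "i \<in> {1..<n}"
    show "signed_act (\<sigma>, \<epsilon>) z (Suc i) < signed_act (\<sigma>, \<epsilon>) z i"
    proof (cases "Suc i = n")
      case True
      have "1 \<le> i" "i < n" using i by auto
      then show ?thesis unfolding True using less[of i n] un ul[OF i] by linarith
    next
      case False
      then show ?thesis using less[of i "Suc i"] ul[of "Suc i"] ul[OF i] i by simp
    qed
  next
    have "n - 1 \<in> {1..<n}" using n by auto
    then show "0 < signed_act (\<sigma>, \<epsilon>) z (n - 1) + signed_act (\<sigma>, \<epsilon>) z n"
      using less[of "n - 1" n] un ul[of "n - 1"] n by (simp add: abs_if split: if_splits)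
  qed
  then show ?thesis using g by blast
qed

text \<open>The bijection sends \<open>g\<close> to the sign pattern of a chosen point of
  \<open>L\<close> in its chamber; the choice is immaterial because roots have constant sign
  there.\<close>

theorem card_chambers_meeting:
  assumes n: "n \<ge> 2"
  shows "card {g \<in> even_signed_perms n. \<exists>z\<in>L. open_chamber n (signed_act g z)} = card (regions (roots_D {1..n}) L)"
proof -
  define G where "G = {g \<in> even_signed_perms n. \<exists>z\<in>L. open_chamber n (signed_act g z)}"
  define w where "w g = (SOME z. z \<in> L \<and> open_chamber n (signed_act g z))" for g
  define T where "T z = {f \<in> roots_D {1..n}. f z > 0}" for z
  have w: "w g \<in> L" "open_chamber n (signed_act g (w g))" "g \<in> even_signed_perms n" if "g \<in> G" for g
    using that someI_ex[of "\<lambda>z. z \<in> L \<and> open_chamber n (signed_act g z)"]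
    unfolding G_def w_def by blast+
  have nv: "\<forall>f\<in>roots_D {1..n}. f z \<noteq> 0"
    if "g \<in> even_signed_perms n" "open_chamber n (signed_act g z)" for g z
  proof
    fix f assume "f \<in> roots_D {1..n}"
    from chamber_root_sign[OF that(1) this] obtain c :: real where "0 < c * f z"
      using \<open>open_chamber n (signed_act g z)\<close> by blast
    then show "f z \<noteq> 0" by auto
  qed
  have same: "T z = T z'"
    if gz: "g \<in> even_signed_perms n" "open_chamber n (signed_act g z)" "open_chamber n (signed_act g z')" for g z z'
  proof -
    have "f z > 0 \<longleftrightarrow> f z' > 0" if f: "f \<in> roots_D {1..n}" for f
    proof -
      obtain c :: real where "0 < c * f z" "0 < c * f z'"
        using chamber_root_sign[OF gz(1) f] gz(2,3) by blast
      then show ?thesis by (auto simp: zero_less_mult_iff)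
    qed
    then show ?thesis unfolding T_def by blast
  qed
  have "bij_betw (T \<circ> w) G (regions (roots_D {1..n}) L)"
    unfolding bij_betw_def
  proof
    show "inj_on (T \<circ> w) G"
    proof (rule inj_onI)
      fix g h assume gh: "g \<in> G" "h \<in> G" "(T \<circ> w) g = (T \<circ> w) h"
      then have "open_chamber n (signed_act g (w h))"
        using chamber_same_signs[OF n w(3)[OF gh(1)] w(2)[OF gh(1)] nv[OF w(3,2)[OF gh(2)]]]
        by (simp add: T_def)
      then show "g = h"
        using chamber_unique[OF n] w gh by blast
    qed
    show "(T \<circ> w) ` G = regions (roots_D {1..n}) L"
    proof (intro equalityI subsetI)
      fix R assume "R \<in> (T \<circ> w) ` G"
      then obtain g where g: "g \<in> G" "R = T (w g)" by auto
      then show "R \<in> regions (roots_D {1..n}) L"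
        using w[OF g(1)] nv[of g "w g"] unfolding regions_def T_def by blast
    next
      fix R assume "R \<in> regions (roots_D {1..n}) L"
      then obtain z where z: "z \<in> L" "\<forall>f\<in>roots_D {1..n}. f z \<noteq> 0" "R = T z"
        unfolding regions_def T_def by blast
      obtain g where g: "g \<in> even_signed_perms n" "open_chamber n (signed_act g z)"
        using chamber_exists[OF n z(2)] by blast
      then have "g \<in> G" using z(1) unfolding G_def by blast
      then show "R \<in> (T \<circ> w) ` G" using same[OF g w(2)] z(3) by force
    qed
  qed
  then show ?thesis unfolding G_def by (rule bij_betw_same_card)
qed

section \<open>Convex hulls of walks and chambers\<close>

text \<open>The boundary value a_(n+1) is kept on the right so that the induction needs no condition
  at the end; in the applications it is 0.\<close>

lemma abel_summation:
  fixes \<eta> :: "nat \<Rightarrow> 'b::real_vector" and a :: "nat \<Rightarrow> real"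
  shows "(\<Sum>k\<in>{1..n}. (a k - a (Suc k)) *\<^sub>R (\<Sum>i\<in>{1..k}. \<eta> i)) = (\<Sum>i\<in>{1..n}. (a i - a (Suc n)) *\<^sub>R \<eta> i)"
proof (induction n)
  case (Suc n)
  have "(\<Sum>i\<in>{1..Suc n}. (a i - a (Suc (Suc n))) *\<^sub>R \<eta> i) =
      (\<Sum>i\<in>{1..Suc n}. (a i - a (Suc n)) *\<^sub>R \<eta> i) + (\<Sum>i\<in>{1..Suc n}. (a (Suc n) - a (Suc (Suc n))) *\<^sub>R \<eta> i)"
    unfolding sum.distrib[symmetric] scaleR_left_distrib[symmetric] by simp
  then show ?case using Suc by (simp add: scaleR_right.sum scaleR_right_distrib algebra_simps)
qed simp

definition hull_event :: "nat \<Rightarrow> (nat \<Rightarrow> 'b::real_vector) \<Rightarrow> bool" where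
  "hull_event n \<eta> \<longleftrightarrow>
    0 \<in> convex hull ((\<lambda>k. \<Sum>i\<in>{1..k}. \<eta> i) ` {1..n} \<union> {(\<Sum>i\<in>{1..n-1}. \<eta> i) - \<eta> n})"

text \<open>With a_(n+1) = 0 the differences a_k - a_(k+1) are nonnegative and telescope to a_1 = 1,
  so they are convex weights for the partial sums.\<close>

lemma decreasing_weights_in_hull:
  fixes \<eta> :: "nat \<Rightarrow> 'b::real_vector" and a :: "nat \<Rightarrow> real"
  assumes dec: "\<And>i. i \<in> {1..<n} \<Longrightarrow> a (Suc i) \<le> a i" and a: "0 \<le> a n" "a 1 = 1" and n: "n \<ge> 1"
  shows "(\<Sum>i\<in>{1..n}. a i *\<^sub>R \<eta> i) \<in> convex hull ((\<lambda>k. \<Sum>i\<in>{1..k}. \<eta> i) ` {1..n})"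
proof -
  define b where "b i = (if i \<le> n then a i else 0)" for i
  have "(\<Sum>k\<in>{1..n}. (b k - b (Suc k)) *\<^sub>R (\<Sum>i\<in>{1..k}. \<eta> i)) \<in> convex hull ((\<lambda>k. \<Sum>i\<in>{1..k}. \<eta> i) ` {1..n})"
  proof (rule convex_sum)
    have "(\<Sum>k\<in>{1..m}. b k - b (Suc k)) = b 1 - b (Suc m)" for m by (induction m) auto
    moreover have "b 1 = 1" "b (Suc n) = 0" using a n by (simp_all add: b_def)
    ultimately show "(\<Sum>k\<in>{1..n}. b k - b (Suc k)) = 1" by (metis diff_zero)
    show "0 \<le> b k - b (Suc k)" if "k \<in> {1..n}" for k
      using that dec[of k] a by (cases "k = n") (auto simp: b_def)
    show "(\<Sum>i\<in>{1..k}. \<eta> i) \<in> convex hull ((\<lambda>k. \<Sum>i\<in>{1..k}. \<eta> i) ` {1..n})" if "k \<in> {1..n}" for k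
      using that by (intro hull_inc) auto
  qed auto
  moreover have "(\<Sum>k\<in>{1..n}. (b k - b (Suc k)) *\<^sub>R (\<Sum>i\<in>{1..k}. \<eta> i)) = (\<Sum>i\<in>{1..n}. a i *\<^sub>R \<eta> i)"
    unfolding abel_summation by (intro sum.cong) (auto simp: b_def)
  ultimately show ?thesis by simp
qed

text \<open>The combinations with weights in the chamber and u_1 = 1 form a convex set containing
  all the points, hence the hull. Conversely the weights are decreasing after the last sign is made
  nonnegative. The normalisation u_1 = 1 excludes the trivial relation.\<close>

lemma hull_event_iff_closed_chamber:
  fixes \<eta> :: "nat \<Rightarrow> 'b::real_vector"
  assumes n: "n \<ge> 2"
  shows "hull_event n \<eta> \<longleftrightarrow> (\<exists>u. closed_chamber n u \<and> u 1 = 1 \<and> (\<Sum>i\<in>{1..n}. u i *\<^sub>R \<eta> i) = 0)"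
proof
  define T where "T = {x. \<exists>u. closed_chamber n u \<and> u 1 = 1 \<and> (\<Sum>i\<in>{1..n}. u i *\<^sub>R \<eta> i) = x}"
  have I: "{1..n} = insert n {1..n-1}" "n \<notin> {1..n-1}" using n by auto
  have "convex T"
  proof (rule convexI)
    fix x y :: 'b and s t :: real
    assume "x \<in> T" "y \<in> T" and st: "0 \<le> s" "0 \<le> t" "s + t = 1"
    then obtain u v where u: "closed_chamber n u" "u 1 = 1" "(\<Sum>i\<in>{1..n}. u i *\<^sub>R \<eta> i) = x"
      and v: "closed_chamber n v" "v 1 = 1" "(\<Sum>i\<in>{1..n}. v i *\<^sub>R \<eta> i) = y"
      unfolding T_def by blast
    have le: "s * a + t * b \<le> s * a' + t * b'" if "a \<le> a'" "b \<le> b'" for a b a' b'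
      using that st by (intro add_mono mult_left_mono) auto
    have "0 \<le> s * (u (n - 1) + u n) + t * (v (n - 1) + v n)"
      using u(1) v(1) le[of 0 "u (n - 1) + u n" 0 "v (n - 1) + v n"] by (simp add: closed_chamber_def)
    then have "closed_chamber n (\<lambda>i. s * u i + t * v i)"
    proof -
      assume last: "0 \<le> s * (u (n - 1) + u n) + t * (v (n - 1) + v n)"
      have "s * u (Suc i) + t * v (Suc i) \<le> s * u i + t * v i" if "i \<in> {1..<n}" for i
        using le u(1) v(1) that unfolding closed_chamber_def by blast
      then show ?thesis using last by (simp add: closed_chamber_def algebra_simps)
    qed
    moreover have "(\<Sum>i\<in>{1..n}. (s * u i + t * v i) *\<^sub>R \<eta> i) = s *\<^sub>R x + t *\<^sub>R y"
      unfolding u(3)[symmetric] v(3)[symmetric]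
      by (simp add: scaleR_right.sum sum.distrib scaleR_left_distrib)
    ultimately show "s *\<^sub>R x + t *\<^sub>R y \<in> T"
      unfolding T_def using u(2) v(2) st(3) by (auto intro!: exI[of _ "\<lambda>i. s * u i + t * v i"])
  qed
  have S: "(\<Sum>i\<in>{1..k}. \<eta> i) \<in> T" if k: "k \<in> {1..n}" for k
  proof -
    have "(\<Sum>i\<in>{1..n}. (if i \<le> k then 1 else 0 :: real) *\<^sub>R \<eta> i) = (\<Sum>i\<in>{1..k}. \<eta> i)"
      by (rule sum.mono_neutral_cong_right) (use k in auto)
    then show ?thesis
      unfolding T_def using k by (auto intro!: exI[of _ "\<lambda>i. if i \<le> k then 1 else 0"] simp: closed_chamber_def)
  qed
  have "(\<Sum>i\<in>{1..n-1}. (if i = n then -1 else 1 :: real) *\<^sub>R \<eta> i) = (\<Sum>i\<in>{1..n-1}. \<eta> i)"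
    by (rule sum.cong) (use n in auto)
  then have "(\<Sum>i\<in>{1..n}. (if i = n then -1 else 1 :: real) *\<^sub>R \<eta> i) = (\<Sum>i\<in>{1..n-1}. \<eta> i) - \<eta> n"
    unfolding I(1) using I(2) by simp
  then have S': "(\<Sum>i\<in>{1..n-1}. \<eta> i) - \<eta> n \<in> T"
    unfolding T_def using n by (auto intro!: exI[of _ "\<lambda>i. if i = n then -1 else 1"] simp: closed_chamber_def)
  have "convex hull ((\<lambda>k. \<Sum>i\<in>{1..k}. \<eta> i) ` {1..n} \<union> {(\<Sum>i\<in>{1..n-1}. \<eta> i) - \<eta> n}) \<subseteq> T"
    using S S' \<open>convex T\<close> by (intro hull_minimal) auto
  then show "hull_event n \<eta> \<Longrightarrow> \<exists>u. closed_chamber n u \<and> u 1 = 1 \<and> (\<Sum>i\<in>{1..n}. u i *\<^sub>R \<eta> i) = 0"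
    unfolding hull_event_def T_def by blast
next
  assume "\<exists>u. closed_chamber n u \<and> u 1 = 1 \<and> (\<Sum>i\<in>{1..n}. u i *\<^sub>R \<eta> i) = 0"
  then obtain u where u: "closed_chamber n u" "u 1 = 1" "(\<Sum>i\<in>{1..n}. u i *\<^sub>R \<eta> i) = 0" by blast
  have I: "{1..n} = insert n {1..n-1}" "n \<notin> {1..n-1}" using n by auto
  show "hull_event n \<eta>"
  proof (cases "0 \<le> u n")
    case True
    have "(\<Sum>i\<in>{1..n}. u i *\<^sub>R \<eta> i) \<in> convex hull ((\<lambda>k. \<Sum>i\<in>{1..k}. \<eta> i) ` {1..n})"
      by (rule decreasing_weights_in_hull) (use u True n in \<open>auto simp: closed_chamber_def\<close>)
    also have "\<dots> \<subseteq> convex hull ((\<lambda>k. \<Sum>i\<in>{1..k}. \<eta> i) ` {1..n} \<union> {(\<Sum>i\<in>{1..n-1}. \<eta> i) - \<eta> n})"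
      by (rule hull_mono) auto
    finally show ?thesis using u(3) by (simp add: hull_event_def)
  next
    case False
    \<comment> \<open>Negating the last step and the last weight keeps the sum, turns S_n into S_n^*
      and makes the weights decreasing and nonnegative.\<close>
    define \<eta>' where "\<eta>' = \<eta>(n := - \<eta> n)"
    define a where "a = u(n := - u n)"
    have "n - 1 \<in> {1..<n}" "Suc (n - 1) = n" using n by auto
    have S: "(\<Sum>i\<in>{1..k}. \<eta>' i) = (\<Sum>i\<in>{1..k}. \<eta> i)" if "k < n" for k
      by (rule sum.cong) (use that in \<open>auto simp: \<eta>'_def\<close>)
    have Sn: "(\<Sum>i\<in>{1..n}. \<eta>' i) = (\<Sum>i\<in>{1..n-1}. \<eta> i) - \<eta> n"
      using I(2) S[of "n - 1"] n unfolding I(1) by (simp add: \<eta>'_def)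
    have "(\<Sum>i\<in>{1..n}. a i *\<^sub>R \<eta>' i) = (\<Sum>i\<in>{1..n}. u i *\<^sub>R \<eta> i)"
      by (rule sum.cong) (auto simp: a_def \<eta>'_def)
    moreover have "(\<Sum>i\<in>{1..n}. a i *\<^sub>R \<eta>' i) \<in> convex hull ((\<lambda>k. \<Sum>i\<in>{1..k}. \<eta>' i) ` {1..n})"
    proof (rule decreasing_weights_in_hull)
      fix i assume i: "i \<in> {1..<n}"
      show "a (Suc i) \<le> a i"
      proof (cases "Suc i = n")
        case True
        then have "n - 1 = i" by simp
        then show ?thesis using True u(1) unfolding closed_chamber_def a_def by auto
      next
        case False
        then show ?thesis using u(1) i unfolding closed_chamber_def a_def by auto
      qed
    qed (use False u n in \<open>auto simp: a_def\<close>)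
    moreover have "(\<lambda>k. \<Sum>i\<in>{1..k}. \<eta>' i) ` {1..n} \<subseteq> (\<lambda>k. \<Sum>i\<in>{1..k}. \<eta> i) ` {1..n} \<union> {(\<Sum>i\<in>{1..n-1}. \<eta> i) - \<eta> n}"
    proof
      fix x assume "x \<in> (\<lambda>k. \<Sum>i\<in>{1..k}. \<eta>' i) ` {1..n}"
      then obtain k where k: "k \<in> {1..n}" "x = (\<Sum>i\<in>{1..k}. \<eta>' i)" by blast
      then show "x \<in> (\<lambda>k. \<Sum>i\<in>{1..k}. \<eta> i) ` {1..n} \<union> {(\<Sum>i\<in>{1..n-1}. \<eta> i) - \<eta> n}"
        using S[of k] Sn by (cases "k = n") auto
    qed
    ultimately show ?thesis
      unfolding hull_event_def using u(3) hull_mono[of _ _ convex] by (metis subsetD)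
  qed
qed

section \<open>Chambers met by the space of linear relations\<close>

definition relations :: "nat \<Rightarrow> (nat \<Rightarrow> 'b::real_vector) \<Rightarrow> (nat \<Rightarrow> real) set" where
  "relations n \<xi> = {x. (\<Sum>i\<in>{1..n}. x i *\<^sub>R \<xi> i) = 0}"

lemma lin_closed_relations: "lin_closed (relations n \<xi>)"
  by (auto simp: lin_closed_def relations_def scaleR_left_distrib sum.distrib
      scaleR_scaleR[symmetric] scaleR_right.sum[symmetric] simp del: scaleR_scaleR)

text \<open>The signs cancel in pairs and the permutation only reindexes. So all transformed walks
  can be studied in one fixed space of relations, with the chamber moving instead.\<close>

lemma sum_signed_act:
  assumes g: "g \<in> even_signed_perms n"
  shows "(\<Sum>i\<in>{1..n}. signed_act g z i *\<^sub>R signed_act g \<xi> i) = (\<Sum>i\<in>{1..n}. z i *\<^sub>R \<xi> i)"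
proof -
  note gD = even_signed_permsD[OF g]
  have "(\<Sum>i\<in>{1..n}. signed_act g z i *\<^sub>R signed_act g \<xi> i) = (\<Sum>i\<in>{1..n}. z (fst g i) *\<^sub>R \<xi> (fst g i))"
    by (rule sum.cong) (use gD(2) in \<open>force simp: signed_act_def\<close>)+
  also have "\<dots> = (\<Sum>i\<in>{1..n}. z i *\<^sub>R \<xi> i)"
    using sum.permute[OF gD(1), of "\<lambda>i. z i *\<^sub>R \<xi> i"] by (simp add: o_def)
  finally show ?thesis .
qed

lemma signed_act_inverse:
  assumes g: "g \<in> even_signed_perms n"
  obtains z where "\<And>i. i \<in> {1..n} \<Longrightarrow> signed_act g z i = (u i :: real)"
proof -
  note gD = even_signed_permsD[OF g]
  define z where "z j = snd g (inv (fst g) j) * u (inv (fst g) j)" for j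
  have "signed_act g z i = u i" if "i \<in> {1..n}" for i
    using gD(2)[OF that] permutes_inverses(2)[OF gD(1)] by (auto simp: signed_act_def z_def)
  then show thesis by (rule that)
qed

text \<open>Take \<open>y\<close> whose image under \<open>g\<close> is (n, ..., 1), an interior
  point, and correct it to \<open>y'\<close> in \<open>L\<close>. On a wall containing
  \<open>z\<close> the correction cancels by oddness, so \<open>y'\<close> points strictly inwards;
  at the other walls a small step does no harm.\<close>

lemma closed_chamber_perturb:
  assumes n: "n \<ge> 2" and g: "g \<in> even_signed_perms n" and gen: "generic {1..n} d L"
    and z: "z \<in> L" "closed_chamber n (signed_act g z)" "signed_act g z 1 \<noteq> 0"
  shows "\<exists>w\<in>L. open_chamber n (signed_act g w)"
proof -
  note gD = even_signed_permsD[OF g]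
  have in1: "fst g i \<in> {1..n}" if "i \<in> {1..n}" for i using permutes_in_image[OF gD(1)] that by blast
  obtain y where y: "\<And>i. i \<in> {1..n} \<Longrightarrow> signed_act g y i = real (Suc n) - real i"
    using signed_act_inverse[OF g, of "\<lambda>i. real (Suc n) - real i"] by blast
  have "fst g 1 \<in> {1..n}" "z (fst g 1) \<noteq> 0" using in1[of 1] n z(3) by (auto simp: signed_act_def)
  from generic_perturb[OF gen finite_atLeastAtMost z(1) this, of y] obtain \<phi> :: "real \<Rightarrow> real" and y' where
    \<phi>': "\<forall>t. \<phi> (- t) = - \<phi> t" and y'': "y' \<in> L" "\<forall>i\<in>{1..n}. y' i = y i + \<phi> (z i)" by blast
  have \<phi>: "\<phi> (- t) = - \<phi> t" for t using \<phi>' by blast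
  have y': "y' \<in> L" "\<And>i. i \<in> {1..n} \<Longrightarrow> y' i = y i + \<phi> (z i)" using y'' by blast+
  have act: "signed_act g y' i = (real (Suc n) - real i) + \<phi> (signed_act g z i)" if "i \<in> {1..n}" for i
    using y[OF that] y'(2)[OF in1[OF that]] gD(2)[OF that] \<phi> by (auto simp: signed_act_def algebra_simps)
  have wact: "signed_act g (\<lambda>i. z i + t * y' i) i = signed_act g z i + t * signed_act g y' i" for t i
    by (simp add: signed_act_def algebra_simps)
  have pos: "\<forall>\<^sub>F t in at_right 0. a + t * b > 0" if "a \<ge> 0" "a = 0 \<Longrightarrow> b > 0" for a b :: real
  proof (cases "a = 0")
    case True
    then show ?thesis using that eventually_at_right_less[of "0::real"] by (auto elim!: eventually_mono)
  next
    case False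
    then show ?thesis using that small_perturbation[of a b] by simp
  qed
  have "\<forall>\<^sub>F t in at_right 0. \<forall>i\<in>{1..<n}. (signed_act g z i - signed_act g z (Suc i)) +
      t * (signed_act g y' i - signed_act g y' (Suc i)) > 0"
  proof (intro eventually_ball_finite ballI pos)
    fix i assume i: "i \<in> {1..<n}"
    then show "0 \<le> signed_act g z i - signed_act g z (Suc i)" using z(2) by (simp add: closed_chamber_def)
    show "0 < signed_act g y' i - signed_act g y' (Suc i)" if "signed_act g z i - signed_act g z (Suc i) = 0"
      using act[of i] act[of "Suc i"] i that by simp
  qed simp
  moreover have "\<forall>\<^sub>F t in at_right 0. (signed_act g z (n - 1) + signed_act g z n) +
      t * (signed_act g y' (n - 1) + signed_act g y' n) > 0"
  proof (rule pos)
    show "0 \<le> signed_act g z (n - 1) + signed_act g z n" using z(2) by (simp add: closed_chamber_def)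
    show "0 < signed_act g y' (n - 1) + signed_act g y' n" if s: "signed_act g z (n - 1) + signed_act g z n = 0"
    proof -
      have "signed_act g z (n - 1) = - signed_act g z n" using s by simp
      then show ?thesis using act[of "n - 1"] act[of n] n \<phi>[of "signed_act g z n"] by simp
    qed
  qed
  ultimately have "\<forall>\<^sub>F t in at_right 0. open_chamber n (signed_act g (\<lambda>i. z i + t * y' i))"
    by eventually_elim (auto simp: open_chamber_def wact algebra_simps)
  then obtain t where "open_chamber n (signed_act g (\<lambda>i. z i + t * y' i))"
    using eventually_happens[of _ "at_right (0::real)"] by auto
  then show ?thesis using lin_closedD[OF genericD_lin[OF gen] z(1) y'(1)] by blast
qed

lemma hull_event_iff_open_chamber:
  fixes \<xi> :: "nat \<Rightarrow> 'b::real_vector"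
  assumes n: "n \<ge> 2" and g: "g \<in> even_signed_perms n" and gen: "generic {1..n} d (relations n \<xi>)"
  shows "hull_event n (signed_act g \<xi>) \<longleftrightarrow> (\<exists>z\<in>relations n \<xi>. open_chamber n (signed_act g z))"
proof
  assume "hull_event n (signed_act g \<xi>)"
  then obtain u where u: "closed_chamber n u" "u 1 = 1" "(\<Sum>i\<in>{1..n}. u i *\<^sub>R signed_act g \<xi> i) = 0"
    using hull_event_iff_closed_chamber[OF n] by blast
  obtain z where z: "\<And>i. i \<in> {1..n} \<Longrightarrow> signed_act g z i = u i"
    using signed_act_inverse[OF g, of u] by blast
  have "z \<in> relations n \<xi>"
    using u(3) z sum_signed_act[OF g, of z \<xi>] by (simp add: relations_def)
  moreover have "closed_chamber n (signed_act g z)" using u(1) z n by (simp add: closed_chamber_def)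
  moreover have "signed_act g z 1 \<noteq> 0" using z[of 1] u(2) n by simp
  ultimately show "\<exists>z\<in>relations n \<xi>. open_chamber n (signed_act g z)"
    using closed_chamber_perturb[OF n g gen] by blast
next
  assume "\<exists>z\<in>relations n \<xi>. open_chamber n (signed_act g z)"
  then obtain z where z: "z \<in> relations n \<xi>" "open_chamber n (signed_act g z)" by blast
  define u where "u i = signed_act g z i / signed_act g z 1" for i
  have pos: "signed_act g z 1 > 0" using open_chamber_less[OF z(2), of 1 n] n by linarith
  have "closed_chamber n u"
    unfolding closed_chamber_def
  proof (intro conjI ballI)
    fix i assume "i \<in> {1..<n}"
    then show "u (Suc i) \<le> u i"
      unfolding u_def using z(2) pos by (intro divide_right_mono) (auto simp: open_chamber_def less_imp_le)
  next
    show "0 \<le> u (n - 1) + u n"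
      unfolding u_def add_divide_distrib[symmetric] using z(2) pos
      by (intro divide_nonneg_nonneg) (auto simp: open_chamber_def less_imp_le)
  qed
  moreover have "u 1 = 1" using pos by (simp add: u_def)
  moreover have "(\<Sum>i\<in>{1..n}. u i *\<^sub>R signed_act g \<xi> i) = 0"
  proof -
    have "(\<Sum>i\<in>{1..n}. u i *\<^sub>R signed_act g \<xi> i) =
        (1 / signed_act g z 1) *\<^sub>R (\<Sum>i\<in>{1..n}. signed_act g z i *\<^sub>R signed_act g \<xi> i)"
      by (simp add: u_def scaleR_right.sum)
    then show ?thesis using z(1) sum_signed_act[OF g, of z \<xi>] by (simp add: relations_def)
  qed
  ultimately show "hull_event n (signed_act g \<xi>)"
    using hull_event_iff_closed_chamber[OF n] by blast
qed

theorem card_hull_events: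
  fixes \<xi> :: "nat \<Rightarrow> 'b::real_vector"
  assumes n: "n \<ge> 2" "d \<le> n" and gen: "generic {1..n} d (relations n \<xi>)"
  shows "int (card {g \<in> even_signed_perms n. hull_event n (signed_act g \<xi>)}) =
    2 * (\<Sum>j\<le>n. Dcoef n (d + 1 + 2 * j))"
proof -
  have eq: "card {g \<in> even_signed_perms n. hull_event n (signed_act g \<xi>)} =
      card (regions (roots_D {1..n}) (relations n \<xi>))"
    unfolding card_chambers_meeting[OF n(1), symmetric]
    by (rule arg_cong[where f = card], rule Collect_cong, rule conj_cong)
      (use hull_event_iff_open_chamber[OF n(1) _ gen] in simp_all)
  show ?thesis
  proof (cases "d < n")
    case True
    then have "count_B n d = card (regions (roots_D {1..n}) (relations n \<xi>)) + n * count_B (n - 1) d"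
      using card_regions_D[OF _ gen] by simp
    then have "int (count_B n d) = int (card (regions (roots_D {1..n}) (relations n \<xi>))) + int n * int (count_B (n - 1) d)"
      by (simp only: of_nat_add of_nat_mult)
    then show ?thesis using count_B_diff[OF n(1), of d] eq by simp
  next
    \<comment> \<open>Here d = n: an element has at most n levels, so the relations are trivial, and
      both sides are 0.\<close>
    case False
    have x0: "x i = 0" if "x \<in> relations n \<xi>" "i \<in> {1..n}" for x i
    proof -
      have "card (levels {1..n} x) \<le> card ((\<lambda>i. \<bar>x i\<bar>) ` {1..n})"
        unfolding levels_def by (intro card_mono) auto
      also have "\<dots> \<le> card {1..n}" by (intro card_image_le) auto
      finally have "card (levels {1..n} x) \<le> d" using False by simp
      then show ?thesis using genericD_zero[OF gen] that by blast
    qed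
    have "pair_root 1 2 1 \<in> roots_D {1..n}" using n by (intro pair_root_in_D) auto
    then have "regions (roots_D {1..n}) (relations n \<xi>) = {}"
    proof (rule regions_eq_empty)
      fix x assume "x \<in> relations n \<xi>"
      then have "x 1 = 0" "x 2 = 0" using x0[of x] n by simp_all
      then show "pair_root 1 2 1 x = 0" by (simp add: pair_root_def)
    qed
    then show ?thesis using eq False n Dcoef_sum_eq_0[of n d] by simp
  qed
qed

lemma generic_UNIV: "generic I 0 UNIV" if "finite I"
proof -
  have "x i = 0" if "card (levels I x) \<le> 0" "i \<in> I" for x i
  proof -
    have "levels I x = {}" using that(1) \<open>finite I\<close> by simp
    then show ?thesis using that(2) unfolding levels_def by auto
  qed
  then show ?thesis
    unfolding generic_def lin_closed_def
    by (auto intro!: exI[of _ "\<lambda>_. 1 :: real"] exI[of "\<lambda>z. \<forall>i\<in>I. z i = _ i"])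
qed

text \<open>Every chamber meets the whole space, which is generic with \<open>d = 0\<close>. So the
  order is the number of type D regions, 2^n n! - n 2^(n-1) (n-1)!.\<close>

lemma card_even_signed_perms:
  assumes n: "n \<ge> 2"
  shows "card (even_signed_perms n) = 2 ^ (n - 1) * fact n"
proof -
  have "\<exists>z. open_chamber n (signed_act g z)" if g: "g \<in> even_signed_perms n" for g
  proof -
    obtain z where z: "\<And>i. i \<in> {1..n} \<Longrightarrow> signed_act g z i = real (Suc n) - real i"
      using signed_act_inverse[OF g, of "\<lambda>i. real (Suc n) - real i"] by blast
    have "open_chamber n (signed_act g z)"
      using z n by (simp add: open_chamber_def)
    then show ?thesis by blast
  qed
  then have "even_signed_perms n = {g \<in> even_signed_perms n. \<exists>z\<in>UNIV. open_chamber n (signed_act g z)}"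
    by blast
  then have "card (even_signed_perms n) = card (regions (roots_D {1..n}) UNIV)"
    using card_chambers_meeting[OF n, of UNIV] by simp
  then have "count_B n 0 = card (even_signed_perms n) + n * count_B (n - 1) 0"
    using card_regions_D[OF _ generic_UNIV, of "{1..n}"] n by simp
  moreover obtain m where "n = Suc m" using n by (cases n) auto
  ultimately show ?thesis by (simp add: count_B_0 algebra_simps del: count_B.simps)
qed

section \<open>General position and measurability\<close>

text \<open>Independence of an indexed family: coinciding partial sums count as dependent.\<close>

definition prefix_indep :: "nat set \<Rightarrow> (nat \<Rightarrow> 'b::real_vector) \<Rightarrow> bool" where
  "prefix_indep I \<eta> \<longleftrightarrow> (\<forall>c. (\<Sum>k\<in>I. c k *\<^sub>R (\<Sum>i\<in>{1..k}. \<eta> i)) = 0 \<longrightarrow> (\<forall>k\<in>I. c k = 0))"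

definition signed_perms :: "nat \<Rightarrow> ((nat \<Rightarrow> nat) \<times> (nat \<Rightarrow> real)) set" where
  "signed_perms n = {\<sigma>. \<sigma> permutes {1..n}} \<times> ({1..n} \<rightarrow>\<^sub>E {-1, 1})"

lemma finite_signed_perms: "finite (signed_perms n)"
  unfolding signed_perms_def by (auto intro!: finite_permutations finite_cartesian_product finite_PiE)

lemma exists_linear_relation:
  fixes w :: "nat \<Rightarrow> 'b::euclidean_space"
  shows "\<exists>c. (\<exists>k\<le>DIM('b). c k \<noteq> 0) \<and> (\<Sum>k\<le>DIM('b). c k *\<^sub>R w k) = 0"
proof (cases "inj_on w {..DIM('b)}")
  case True
  then have "card (w ` {..DIM('b)}) = Suc DIM('b)" by (simp add: card_image)
  then have "dependent (w ` {..DIM('b)})" by (intro dependent_biggerset) auto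
  then obtain u where u: "\<exists>v\<in>w ` {..DIM('b)}. u v \<noteq> 0" "(\<Sum>v\<in>w ` {..DIM('b)}. u v *\<^sub>R v) = 0"
    using dependent_finite[of "w ` {..DIM('b)}"] by auto
  then show ?thesis
    using sum.reindex[OF True, of "\<lambda>v. u v *\<^sub>R v"] by (intro exI[of _ "u \<circ> w"]) auto
next
  case False
  then obtain a b where ab: "a \<le> DIM('b)" "b \<le> DIM('b)" "a \<noteq> b" "w a = w b" by (auto simp: inj_on_def)
  define c where "c k = (if k = a then 1 else 0 :: real) - (if k = b then 1 else 0)" for k
  have "(\<Sum>k\<le>DIM('b). c k *\<^sub>R w k) =
      (\<Sum>k\<le>DIM('b). if k = a then w k else 0) - (\<Sum>k\<le>DIM('b). if k = b then w k else 0)"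
    unfolding sum_subtractf[symmetric] by (intro sum.cong) (auto simp: c_def)
  also have "\<dots> = 0" using ab by simp
  finally show ?thesis using ab by (intro exI[of _ c]) (auto simp: c_def)
qed

text \<open>Sort the absolute values decreasingly and move the signs, possibly an odd number, into
  the steps. Abel summation then gives a relation between partial sums whose nonzero coefficients
  sit at the drops. Distinct drops have distinct nonzero levels, so there are at most
  \<open>d\<close> of them and independence removes them all.\<close>

lemma relations_zero:
  fixes \<xi> :: "nat \<Rightarrow> 'b::real_vector"
  assumes indep: "\<And>g I. g \<in> signed_perms n \<Longrightarrow> I \<subseteq> {1..n} \<Longrightarrow> card I = d \<Longrightarrow> prefix_indep I (signed_act g \<xi>)"
    and d: "d \<le> n" and x: "x \<in> relations n \<xi>" "card (levels {1..n} x) \<le> d" and i: "i \<in> {1..n}"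
  shows "x i = 0"
proof -
  obtain \<sigma> where \<sigma>: "\<sigma> permutes {1..n}"
      "\<And>i j. 1 \<le> i \<Longrightarrow> i \<le> j \<Longrightarrow> j \<le> n \<Longrightarrow> \<bar>x (\<sigma> j)\<bar> \<le> \<bar>x (\<sigma> i)\<bar>"
    using ex_sorting_permutation[of n "\<lambda>i. \<bar>x i\<bar>"] by blast
  define \<epsilon> where "\<epsilon> = (\<lambda>i\<in>{1..n}. if x (\<sigma> i) < 0 then -1 else 1 :: real)"
  define \<eta> where "\<eta> = signed_act (\<sigma>, \<epsilon>) \<xi>"
  have g: "(\<sigma>, \<epsilon>) \<in> signed_perms n" using \<sigma>(1) by (auto simp: signed_perms_def \<epsilon>_def)
  define a where "a i = (if i \<le> n then \<bar>x (\<sigma> i)\<bar> else 0)" for i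
  have anti: "a j \<le> a i" if "1 \<le> i" "i \<le> j" for i j
    using \<sigma>(2)[OF that] that by (auto simp: a_def)
  have "(\<Sum>i\<in>{1..n}. (a i - a (Suc n)) *\<^sub>R \<eta> i) = (\<Sum>i\<in>{1..n}. x (\<sigma> i) *\<^sub>R \<xi> (\<sigma> i))"
    by (rule sum.cong) (auto simp: a_def \<eta>_def signed_act_def \<epsilon>_def)
  also have "\<dots> = 0"
    using x(1) sum.permute[OF \<sigma>(1), of "\<lambda>i. x i *\<^sub>R \<xi> i"] by (simp add: relations_def o_def)
  finally have sum0: "(\<Sum>k\<in>{1..n}. (a k - a (Suc k)) *\<^sub>R (\<Sum>i\<in>{1..k}. \<eta> i)) = 0"
    unfolding abel_summation .
  define K where "K = {k \<in> {1..n}. a k \<noteq> a (Suc k)}"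
  have Kless: "a (Suc k) < a k" if "k \<in> K" for k
    using that anti[of k "Suc k"] by (simp add: K_def)
  have "inj_on a K"
  proof (rule inj_onI)
    fix k l assume kl: "k \<in> K" "l \<in> K" "a k = a l"
    have False if "k' < l'" "k' \<in> K" "l' \<in> K" "a k' = a l'" for k' l'
      using Kless[OF that(2)] anti[of "Suc k'" l'] that by simp
    then show "k = l" using kl by (metis linorder_neqE_nat)
  qed
  moreover have "a ` K \<subseteq> levels {1..n} x"
  proof
    fix t assume "t \<in> a ` K"
    then obtain k where k: "k \<in> K" "t = a k" by blast
    have "0 \<le> a (Suc k)" by (simp add: a_def)
    then have "t \<noteq> 0" using Kless[OF k(1)] k(2) by simp
    moreover have "\<sigma> k \<in> {1..n}" using k(1) permutes_in_image[OF \<sigma>(1), of k] by (simp add: K_def)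
    ultimately show "t \<in> levels {1..n} x" using k by (auto simp: levels_def K_def a_def)
  qed
  ultimately have "card K \<le> card (levels {1..n} x)"
    by (metis card_image card_mono finite_atLeastAtMost finite_levels)
  \<comment> \<open>Independence is available for sets of exactly \<open>d\<close> indices, so the
    drops are padded with zero coefficients.\<close>
  then have "\<exists>I. K \<subseteq> I \<and> I \<subseteq> {1..n} \<and> card I = d"
    using x(2) d by (intro exists_subset_between) (auto simp: K_def)
  then obtain I where I: "K \<subseteq> I" "I \<subseteq> {1..n}" "card I = d" by blast
  have "(\<Sum>k\<in>I. (a k - a (Suc k)) *\<^sub>R (\<Sum>i\<in>{1..k}. \<eta> i)) = (\<Sum>k\<in>{1..n}. (a k - a (Suc k)) *\<^sub>R (\<Sum>i\<in>{1..k}. \<eta> i))"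
    by (rule sum.mono_neutral_left) (use I in \<open>auto simp: K_def\<close>)
  then have "\<forall>k\<in>I. a k - a (Suc k) = 0"
    using indep[OF g I(2,3)] sum0 unfolding prefix_indep_def \<eta>_def by auto
  then have step: "a k = a (Suc k)" if "k \<in> {1..n}" for k using I(1) that by (auto simp: K_def)
  have "a k = 0" if "k \<in> {1..n}" for k
  proof -
    have "k \<le> Suc n" "1 \<le> k" using that by auto
    then show ?thesis
    proof (induction k rule: inc_induct)
      case base
      show ?case by (simp add: a_def)
    next
      case (step m)
      then show ?case using \<open>\<And>k. k \<in> {1..n} \<Longrightarrow> a k = a (Suc k)\<close>[of m] by simp
    qed
  qed
  moreover obtain k where "k \<in> {1..n}" "\<sigma> k = i" using permutes_image_ex[OF \<sigma>(1) i] by blast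
  ultimately show ?thesis by (fastforce simp: a_def)
qed

text \<open>The codimension bound holds because the relations are the kernel of a linear map into a
  space of dimension \<open>DIM('b)\<close>.\<close>

lemma generic_relations:
  fixes \<xi> :: "nat \<Rightarrow> 'b::euclidean_space"
  assumes indep: "\<And>g I. g \<in> signed_perms n \<Longrightarrow> I \<subseteq> {1..n} \<Longrightarrow> card I = DIM('b) \<Longrightarrow>
      prefix_indep I (signed_act g \<xi>)"
    and d: "DIM('b) \<le> n"
  shows "generic {1..n} DIM('b) (relations n \<xi>)"
  unfolding generic_def
proof (intro conjI allI ballI impI)
  show "lin_closed (relations n \<xi>)" by (rule lin_closed_relations)
next
  fix x i assume "x \<in> relations n \<xi>" "card (levels {1..n} x) \<le> DIM('b)" "i \<in> {1..n}"
  then show "x i = 0" using relations_zero[OF indep d] by blast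
next
  fix v :: "nat \<Rightarrow> nat \<Rightarrow> real"
  obtain c where c: "\<exists>k\<le>DIM('b). c k \<noteq> 0" "(\<Sum>k\<le>DIM('b). c k *\<^sub>R (\<Sum>i\<in>{1..n}. v k i *\<^sub>R \<xi> i)) = 0"
    using exists_linear_relation[of "\<lambda>k. \<Sum>i\<in>{1..n}. v k i *\<^sub>R \<xi> i"] by blast
  have "(\<Sum>i\<in>{1..n}. (\<Sum>k\<le>DIM('b). c k * v k i) *\<^sub>R \<xi> i) = (\<Sum>i\<in>{1..n}. \<Sum>k\<le>DIM('b). (c k * v k i) *\<^sub>R \<xi> i)"
    by (simp add: scaleR_left.sum)
  also have "\<dots> = (\<Sum>k\<le>DIM('b). \<Sum>i\<in>{1..n}. (c k * v k i) *\<^sub>R \<xi> i)" by (rule sum.swap)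
  also have "\<dots> = 0" using c(2) by (simp add: scaleR_right.sum)
  finally have "(\<lambda>i. \<Sum>k\<le>DIM('b). c k * v k i) \<in> relations n \<xi>" by (simp add: relations_def)
  then show "\<exists>c z. (\<exists>k\<le>DIM('b). c k \<noteq> 0) \<and> z \<in> relations n \<xi> \<and> (\<forall>i\<in>{1..n}. z i = (\<Sum>k\<le>DIM('b). c k * v k i))"
    using c(1) by blast
qed

lemma prefix_indepI:
  assumes "finite I" "inj_on (\<lambda>k. \<Sum>i\<in>{1..k}. \<eta> i) I" "independent ((\<lambda>k. \<Sum>i\<in>{1..k}. \<eta> i) ` I)"
  shows "prefix_indep I \<eta>"
  unfolding prefix_indep_def
proof (intro allI impI ballI)
  define S where "S k = (\<Sum>i\<in>{1..k}. \<eta> i)" for k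
  fix c k assume c: "(\<Sum>k\<in>I. c k *\<^sub>R (\<Sum>i\<in>{1..k}. \<eta> i)) = 0" and k: "k \<in> I"
  have S: "inj_on S I" "independent (S ` I)" "(\<Sum>k\<in>I. c k *\<^sub>R S k) = 0"
    using assms c unfolding S_def by auto
  define u where "u v = c (inv_into I S v)" for v
  have "(\<Sum>v\<in>S ` I. u v *\<^sub>R v) = (\<Sum>k\<in>I. c k *\<^sub>R S k)"
    using S(1) by (simp add: sum.reindex u_def)
  then have "\<forall>v\<in>S ` I. u v = 0"
    using S assms(1) dependent_finite[of "S ` I"] by auto
  then show "c k = 0" using S(1) k by (auto simp: u_def)
qed

section \<open>Measurability of independence and of the hull event\<close>

lemma prefix_indep_iff_det:
  fixes \<eta> :: "nat \<Rightarrow> real ^ 'd"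
  assumes f: "bij_betw f (UNIV :: 'd set) I"
  shows "prefix_indep I \<eta> \<longleftrightarrow> det (\<chi> a b. (\<Sum>i\<in>{1..f b}. \<eta> i) $ a) \<noteq> 0"
proof -
  define S where "S k = (\<Sum>i\<in>{1..k}. \<eta> i)" for k
  define A where "A = (\<chi> a b. S (f b) $ a)"
  have A: "A *v x = (\<Sum>b\<in>UNIV. x $ b *\<^sub>R S (f b))" for x
    by (simp add: vec_eq_iff matrix_vector_mult_def A_def mult.commute)
  have re: "(\<Sum>b\<in>UNIV. c (f b) *\<^sub>R S (f b)) = (\<Sum>k\<in>I. c k *\<^sub>R S k)" for c
    by (rule sum.reindex_bij_betw[OF f])
  have inv: "inv f (f b) = b" for b using f by (simp add: bij_betw_def)
  have ex: "\<exists>b. k = f b" if "k \<in> I" for k using f that by (auto simp: bij_betw_def)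
  have "prefix_indep I \<eta> \<longleftrightarrow> (\<forall>x. A *v x = 0 \<longrightarrow> x = 0)"
  proof
    assume p: "prefix_indep I \<eta>"
    show "\<forall>x. A *v x = 0 \<longrightarrow> x = 0"
    proof (intro allI impI)
      fix x assume "A *v x = 0"
      then have "(\<Sum>k\<in>I. (x $ inv f k) *\<^sub>R S k) = 0"
        using re[of "\<lambda>k. x $ inv f k"] by (simp add: A inv)
      moreover have "(\<Sum>k\<in>I. (x $ inv f k) *\<^sub>R S k) = 0 \<longrightarrow> (\<forall>k\<in>I. x $ inv f k = 0)"
        using p unfolding prefix_indep_def S_def by (rule spec)
      ultimately have "\<forall>k\<in>I. x $ inv f k = 0" by blast
      then show "x = 0" using f by (auto simp: vec_eq_iff bij_betw_def inv)
    qed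
  next
    assume k: "\<forall>x. A *v x = 0 \<longrightarrow> x = 0"
    show "prefix_indep I \<eta>"
      unfolding prefix_indep_def S_def[symmetric]
    proof (intro allI impI ballI)
      fix c k assume c: "(\<Sum>k\<in>I. c k *\<^sub>R S k) = 0" and kI: "k \<in> I"
      have "A *v (\<chi> b. c (f b)) = 0" using re[of c] c by (simp add: A)
      then have "(\<chi> b. c (f b)) = 0" using k by blast
      then have "c (f b) = 0" for b by (simp add: vec_eq_iff)
      then show "c k = 0" using ex[OF kI] by auto
    qed
  qed
  also have "\<dots> \<longleftrightarrow> invertible A"
    unfolding invertible_left_inverse matrix_left_invertible_ker by simp
  also have "\<dots> \<longleftrightarrow> det A \<noteq> 0" by (rule invertible_det_nz)
  finally show ?thesis by (simp add: A_def S_def)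
qed

lemma measurable_vec_nth: "(\<lambda>x :: real ^ 'd. x $ a) \<in> borel_measurable borel"
  by (intro borel_measurable_continuous_onI continuous_intros)

lemma sets_prefix_indep:
  fixes \<eta> :: "nat \<Rightarrow> 'a \<Rightarrow> real ^ 'd"
  assumes \<eta>: "\<And>i. i \<in> {1..n} \<Longrightarrow> \<eta> i \<in> borel_measurable N" and I: "I \<subseteq> {1..n}" "card I = CARD('d)"
  shows "{w \<in> space N. prefix_indep I (\<lambda>i. \<eta> i w)} \<in> sets N"
proof -
  have "finite I" using I(1) finite_subset by blast
  then obtain f where f: "bij_betw f (UNIV :: 'd set) I"
    using finite_same_card_bij[of "UNIV :: 'd set" I] I(2) by auto
  have fI: "f b \<in> {1..n}" for b using bij_betwE[OF f] I(1) by blast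
  have "(\<lambda>w. (\<Sum>i\<in>{1..f b}. \<eta> i w) $ a) \<in> borel_measurable N" for a b
    by (rule measurable_compose[OF _ measurable_vec_nth], rule borel_measurable_sum, rule \<eta>)
      (use fI[of b] in auto)
  then have "(\<lambda>w. det (\<chi> a b. (\<Sum>i\<in>{1..f b}. \<eta> i w) $ a)) \<in> borel_measurable N"
    unfolding det_def by (simp del: vec_sum sum_component) (measurable)
  then have "(\<lambda>w. det (\<chi> a b. (\<Sum>i\<in>{1..f b}. \<eta> i w) $ a)) -` (- {0}) \<inter> space N \<in> sets N"
    by (rule measurable_sets) auto
  also have "(\<lambda>w. det (\<chi> a b. (\<Sum>i\<in>{1..f b}. \<eta> i w) $ a)) -` (- {0}) \<inter> space N =
      {w \<in> space N. prefix_indep I (\<lambda>i. \<eta> i w)}"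
    unfolding prefix_indep_iff_det[OF f] by auto
  finally show ?thesis .
qed

text \<open>If 0 is outside, some normal is strictly positive on all of \<open>P\<close>. Since
  \<open>P\<close> is finite such normals form an open set, which meets the dense set
  \<open>D\<close>; countably many tests therefore suffice.\<close>

lemma zero_in_convex_hull_finite_iff:
  fixes P :: "'b::euclidean_space set"
  assumes D: "\<And>X. open X \<Longrightarrow> X \<noteq> {} \<Longrightarrow> \<exists>u\<in>D. u \<in> X" and P: "finite P"
  shows "0 \<in> convex hull P \<longleftrightarrow> (\<forall>u\<in>D. \<exists>p\<in>P. u \<bullet> p \<le> 0)"
proof
  assume 0: "0 \<in> convex hull P"
  show "\<forall>u\<in>D. \<exists>p\<in>P. u \<bullet> p \<le> 0"
  proof (rule ballI, rule ccontr)
    fix u assume "\<not> (\<exists>p\<in>P. u \<bullet> p \<le> 0)"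
    then have "convex hull P \<subseteq> {x. u \<bullet> x > 0}"
      by (intro hull_minimal convex_halfspace_gt) auto
    then show False using 0 by auto
  qed
next
  assume u: "\<forall>u\<in>D. \<exists>p\<in>P. u \<bullet> p \<le> 0"
  show "0 \<in> convex hull P"
  proof (rule ccontr)
    assume "0 \<notin> convex hull P"
    moreover have "closed (convex hull P)"
      using P by (intro compact_imp_closed finite_imp_compact_convex_hull)
    ultimately obtain a b where ab: "0 < b" "\<forall>x\<in>convex hull P. a \<bullet> x > b"
      using separating_hyperplane_closed_0[of "convex hull P"] by auto
    define X where "X = (\<Inter>p\<in>P. {u. u \<bullet> p > 0})"
    have "open X"
      unfolding X_def using P by (intro open_INT ballI open_Collect_less continuous_intros)
    moreover have "a \<bullet> p > 0" if "p \<in> P" for p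
      using ab hull_inc[OF that, of convex] by (meson less_trans)
    then have "a \<in> X" by (simp add: X_def)
    ultimately obtain u where "u \<in> D" "u \<in> X" using D[of X] by blast
    then show False using u unfolding X_def by force
  qed
qed

lemma sets_hull_event:
  fixes \<eta> :: "nat \<Rightarrow> 'a \<Rightarrow> 'b::euclidean_space"
  assumes \<eta>: "\<And>i. i \<in> {1..n} \<Longrightarrow> \<eta> i \<in> borel_measurable N" and n: "n \<ge> 1"
  shows "{w \<in> space N. hull_event n (\<lambda>i. \<eta> i w)} \<in> sets N"
proof -
  obtain D :: "'b set" where D: "countable D" "\<And>X. open X \<Longrightarrow> X \<noteq> {} \<Longrightarrow> \<exists>u\<in>D. u \<in> X"
    using countable_dense_exists[where 'a = 'b] by blast
  define S where "S k w = (if k = 0 then (\<Sum>i\<in>{1..n-1}. \<eta> i w) - \<eta> n w else (\<Sum>i\<in>{1..k}. \<eta> i w))" for k w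
  have S: "S k \<in> borel_measurable N" if "k \<le> n" for k
  proof (cases "k = 0")
    case True
    have "(\<lambda>w. (\<Sum>i\<in>{1..n-1}. \<eta> i w) - \<eta> n w) \<in> borel_measurable N"
      using n by (intro borel_measurable_diff borel_measurable_sum \<eta>) auto
    then show ?thesis using True by (simp add: S_def[abs_def])
  next
    case False
    have "(\<lambda>w. \<Sum>i\<in>{1..k}. \<eta> i w) \<in> borel_measurable N"
      using that by (intro borel_measurable_sum \<eta>) auto
    then show ?thesis using False by (simp add: S_def[abs_def])
  qed
  have "hull_event n (\<lambda>i. \<eta> i w) \<longleftrightarrow> (\<forall>u\<in>D. \<exists>k\<in>{..n}. u \<bullet> S k w \<le> 0)" for w
  proof -
    have "(\<lambda>k. \<Sum>i\<in>{1..k}. \<eta> i w) ` {1..n} = (\<lambda>k. S k w) ` {1..n}"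
      by (rule image_cong) (auto simp: S_def)
    moreover have "{(\<Sum>i\<in>{1..n-1}. \<eta> i w) - \<eta> n w} = (\<lambda>k. S k w) ` {0}" by (simp add: S_def)
    moreover have "{1..n} \<union> {0} = {..n}" by auto
    ultimately have "(\<lambda>k. \<Sum>i\<in>{1..k}. \<eta> i w) ` {1..n} \<union> {(\<Sum>i\<in>{1..n-1}. \<eta> i w) - \<eta> n w} = (\<lambda>k. S k w) ` {..n}"
      by (metis image_Un)
    then show ?thesis
      unfolding hull_event_def using zero_in_convex_hull_finite_iff[OF D(2), of "(\<lambda>k. S k w) ` {..n}"] by simp
  qed
  moreover have "{w \<in> space N. \<forall>u\<in>D. \<exists>k\<in>{..n}. u \<bullet> S k w \<le> 0} \<in> sets N"
  proof (intro sets.sets_Collect_countable_All'[OF _ D(1)] sets.sets_Collect_finite_Ex finite_atMost)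
    fix u k assume "k \<in> {..n}"
    then show "{w \<in> space N. u \<bullet> S k w \<le> 0} \<in> sets N"
      using S[of k] by (intro borel_measurable_le borel_measurable_inner) auto
  qed
  ultimately show ?thesis by simp
qed

lemma hull_event_cong:
  assumes "\<And>i. i \<in> {1..n} \<Longrightarrow> \<eta> i = \<eta>' i" "n \<ge> 1"
  shows "hull_event n \<eta> \<longleftrightarrow> hull_event n \<eta>'"
proof -
  have S: "(\<Sum>i\<in>{1..k}. \<eta> i) = (\<Sum>i\<in>{1..k}. \<eta>' i)" if "k \<le> n" for k
    using assms(1) that by (intro sum.cong) auto
  have "(\<lambda>k. \<Sum>i\<in>{1..k}. \<eta> i) ` {1..n} = (\<lambda>k. \<Sum>i\<in>{1..k}. \<eta>' i) ` {1..n}"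
    by (rule image_cong) (use S in auto)
  moreover have "(\<Sum>i\<in>{1..n-1}. \<eta> i) - \<eta> n = (\<Sum>i\<in>{1..n-1}. \<eta>' i) - \<eta>' n"
    using S[of "n - 1"] assms by simp
  ultimately show ?thesis unfolding hull_event_def by (simp only:)
qed

lemma prefix_indep_cong:
  assumes "\<And>i. i \<in> {1..n} \<Longrightarrow> \<eta> i = \<eta>' i" "I \<subseteq> {1..n}"
  shows "prefix_indep I \<eta> \<longleftrightarrow> prefix_indep I \<eta>'"
proof -
  have "(\<Sum>i\<in>{1..k}. \<eta> i) = (\<Sum>i\<in>{1..k}. \<eta>' i)" if "k \<in> I" for k
    using assms that by (intro sum.cong) auto
  then show ?thesis by (simp add: prefix_indep_def cong: sum.cong)
qed

lemma (in prob_space) sum_prob_eq_const_count: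
  assumes "finite G" "\<And>g. g \<in> G \<Longrightarrow> {\<omega> \<in> space M. E g \<omega>} \<in> events"
    and "AE \<omega> in M. real (card {g \<in> G. E g \<omega>}) = K"
  shows "(\<Sum>g\<in>G. prob {\<omega> \<in> space M. E g \<omega>}) = K"
proof -
  have card: "real (card {g \<in> G. E g \<omega>}) = (\<Sum>g\<in>G. indicator {\<omega> \<in> space M. E g \<omega>} \<omega>)"
    if "\<omega> \<in> space M" for \<omega>
  proof -
    have "(\<Sum>g\<in>G. indicator {\<omega> \<in> space M. E g \<omega>} \<omega> :: real) = (\<Sum>g\<in>G. if E g \<omega> then 1 else 0)"
      using that by (intro sum.cong) auto
    then show ?thesis using assms(1) by (simp add: sum.inter_filter[symmetric])
  qed
  have meas: "(\<lambda>\<omega>. \<Sum>g\<in>G. indicator {\<omega> \<in> space M. E g \<omega>} \<omega> :: real) \<in> borel_measurable M"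
    using assms(2) by (intro borel_measurable_sum borel_measurable_indicator)
  have "(\<Sum>g\<in>G. prob {\<omega> \<in> space M. E g \<omega>}) =
      (\<Sum>g\<in>G. expectation (indicator {\<omega> \<in> space M. E g \<omega>} :: 'a \<Rightarrow> real))"
    using assms(2) by simp
  also have "\<dots> = expectation (\<lambda>\<omega>. \<Sum>g\<in>G. indicator {\<omega> \<in> space M. E g \<omega>} \<omega>)"
    using assms(2) by (intro Bochner_Integration.integral_sum[symmetric]) (auto simp: less_top[symmetric])
  also have "\<dots> = expectation (\<lambda>\<omega>. K)"
  proof (rule integral_cong_AE[OF meas])
    show "AE \<omega> in M. (\<Sum>g\<in>G. indicator {\<omega> \<in> space M. E g \<omega>} \<omega>) = K"
      using assms(3) AE_space by eventually_elim (simp add: card)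
  qed simp
  also have "\<dots> = K" by (simp add: prob_space)
  finally show ?thesis .
qed

section \<open>From exchangeability to the probability\<close>

theorem theorem2p7:
  fixes M :: "'a measure" and \<xi> :: "nat \<Rightarrow> 'a \<Rightarrow> real ^ 'd" and n :: nat
  assumes "prob_space M"
    and "n \<ge> 2" and "n \<ge> CARD('d)"
    and meas: "\<And>i. i \<in> {1..n} \<Longrightarrow> \<xi> i \<in> borel_measurable M"
    and exch: "\<And>\<sigma> \<epsilon>. \<sigma> permutes {1..n} \<Longrightarrow> (\<forall>i\<in>{1..n}. \<epsilon> i \<in> {-1, 1::real}) \<Longrightarrow>
        (\<Prod>i\<in>{1..n}. \<epsilon> i) = 1 \<Longrightarrow>
        distr M (Pi\<^sub>M {1..n} (\<lambda>_. borel)) (\<lambda>\<omega>. \<lambda>i\<in>{1..n}. \<xi> i \<omega>) =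
        distr M (Pi\<^sub>M {1..n} (\<lambda>_. borel)) (\<lambda>\<omega>. \<lambda>i\<in>{1..n}. \<epsilon> i *\<^sub>R \<xi> (\<sigma> i) \<omega>)"
    and gp1: "\<And>I. I \<subseteq> {1..n} \<Longrightarrow> card I = CARD('d) \<Longrightarrow>
        AE \<omega> in M. inj_on (\<lambda>k. psum \<xi> k \<omega>) I \<and> independent ((\<lambda>k. psum \<xi> k \<omega>) ` I)"
    and gp2: "\<And>I. I \<subseteq> {1..n} \<Longrightarrow> card I = CARD('d) \<Longrightarrow>
        AE \<omega> in M. inj_on (\<lambda>k. psum_alt \<xi> n k \<omega>) I \<and> independent ((\<lambda>k. psum_alt \<xi> n k \<omega>) ` I)"
  shows "measure M {\<omega> \<in> space M.
            0 \<in> convex hull ((\<lambda>k. psum \<xi> k \<omega>) ` {1..n} \<union> {psum_star \<xi> n \<omega>})} =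
         2 / (2 ^ (n - 1) * fact n) * (\<Sum>j\<le>n. real_of_int (Dcoef n (CARD('d) + 1 + 2 * j)))"
proof -
  interpret prob_space M by fact
  have n: "n \<ge> 2" by fact
  define N where "N = Pi\<^sub>M {1..n} (\<lambda>_. borel :: (real ^ 'd) measure)"
  define X where "X \<omega> = (\<lambda>i\<in>{1..n}. \<xi> i \<omega>)" for \<omega>
  define Z where "Z g \<omega> = (\<lambda>i\<in>{1..n}. snd g i *\<^sub>R \<xi> (fst g i) \<omega>)" for g \<omega>
  have Z: "Z g \<omega> i = signed_act g (\<lambda>i. \<xi> i \<omega>) i" if "i \<in> {1..n}" for g \<omega> i
    using that by (simp add: Z_def signed_act_def)
  define flip where "flip x = (\<lambda>i. if i = n then - x i else x i)" for x :: "nat \<Rightarrow> real ^ 'd"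
  have mX: "X \<in> measurable M N"
    unfolding X_def[abs_def] N_def using meas by (intro measurable_restrict) auto
  have mZ: "Z g \<in> measurable M N" if "fst g permutes {1..n}" for g
    unfolding Z_def[abs_def] N_def
    using meas permutes_in_image[OF that] by (intro measurable_restrict borel_measurable_scaleR) auto
  have mc: "(\<lambda>x. x i) \<in> borel_measurable N" if "i \<in> {1..n}" for i
    unfolding N_def using that by (rule measurable_component_singleton)
  have dist: "distr M N X = distr M N (Z g)" if "g \<in> even_signed_perms n" for g
    unfolding N_def X_def[abs_def] Z_def[abs_def]
    by (rule exch) (use even_signed_permsD[OF that] in auto)
  \<comment> \<open>Equality of laws carries almost sure properties of the steps to every even
    signed permutation of them.\<close>
  have transfer: "AE \<omega> in M. P (Z g \<omega>)"
    if P: "{x \<in> space N. P x} \<in> sets N" and ae: "AE \<omega> in M. P (X \<omega>)" and g: "g \<in> even_signed_perms n" for P g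
    using ae AE_distr_iff[OF mX P] AE_distr_iff[OF mZ[OF even_signed_permsD(1)[OF g]] P]
    unfolding dist[OF g] by blast
  have alt: "psum_alt \<xi> n k \<omega> = (\<Sum>i\<in>{1..k}. flip (X \<omega>) i)" if "k \<in> {1..n}" for k \<omega>
  proof -
    have S: "(\<Sum>i\<in>{1..m}. flip (X \<omega>) i) = (\<Sum>i\<in>{1..m}. \<xi> i \<omega>)" if "m < n" for m
      using that by (intro sum.cong) (auto simp: flip_def X_def)
    have "{1..n} = insert n {1..n-1}" "n \<notin> {1..n-1}" using n by auto
    then have "(\<Sum>i\<in>{1..n}. flip (X \<omega>) i) = (\<Sum>i\<in>{1..n-1}. \<xi> i \<omega>) - \<xi> n \<omega>"
      using S[of "n - 1"] n by (simp add: flip_def X_def)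
    then show ?thesis
      using S[of k] that by (auto simp: psum_alt_def psum_star_def psum_def)
  qed
  have indepX: "AE \<omega> in M. prefix_indep I (X \<omega>)" if I: "I \<subseteq> {1..n}" "card I = CARD('d)" for I
    using gp1[OF I]
  proof eventually_elim
    case (elim \<omega>)
    then have "inj_on (\<lambda>k. \<Sum>i\<in>{1..k}. \<xi> i \<omega>) I" "independent ((\<lambda>k. \<Sum>i\<in>{1..k}. \<xi> i \<omega>) ` I)"
      unfolding psum_def by blast+
    then have "prefix_indep I (\<lambda>i. \<xi> i \<omega>)"
      by (rule prefix_indepI[OF finite_subset[OF I(1) finite_atLeastAtMost]])
    then show ?case using prefix_indep_cong[OF _ I(1), of "X \<omega>" "\<lambda>i. \<xi> i \<omega>"] by (simp add: X_def)
  qed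
  have indepF: "AE \<omega> in M. prefix_indep I (flip (X \<omega>))" if I: "I \<subseteq> {1..n}" "card I = CARD('d)" for I
    using gp2[OF I]
  proof eventually_elim
    case (elim \<omega>)
    have eq: "psum_alt \<xi> n k \<omega> = (\<Sum>i\<in>{1..k}. flip (X \<omega>) i)" if "k \<in> I" for k using alt that I(1) by blast
    have "inj_on (\<lambda>k. \<Sum>i\<in>{1..k}. flip (X \<omega>) i) I" "independent ((\<lambda>k. \<Sum>i\<in>{1..k}. flip (X \<omega>) i) ` I)"
      using elim eq by (simp_all cong: inj_on_cong image_cong)
    then show ?case
      by (rule prefix_indepI[OF finite_subset[OF I(1) finite_atLeastAtMost]])
  qed
  have indep: "AE \<omega> in M. prefix_indep I (signed_act g (\<lambda>i. \<xi> i \<omega>))"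
    if g: "g \<in> signed_perms n" and I: "I \<subseteq> {1..n}" "card I = CARD('d)" for g I
  proof -
    have sg: "snd g i \<in> {-1, 1}" if "i \<in> {1..n}" for i using g that by (auto simp: signed_perms_def)
    have "snd g i * snd g i = 1" if "i \<in> {1..n}" for i using sg[OF that] by auto
    then have "(\<Prod>i\<in>{1..n}. snd g i) * (\<Prod>i\<in>{1..n}. snd g i) = 1"
      unfolding prod.distrib[symmetric] by (intro prod.neutral) simp
    then consider "(\<Prod>i\<in>{1..n}. snd g i) = 1" | "(\<Prod>i\<in>{1..n}. snd g i) = -1"
      by (auto simp: square_eq_1_iff)
    then show ?thesis
    proof cases
      case 1
      then have "g \<in> even_signed_perms n" using g by (auto simp: signed_perms_def even_signed_perms_def)
      moreover have "{x \<in> space N. prefix_indep I x} \<in> sets N"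
        by (rule sets_prefix_indep[OF _ I]) (rule mc)
      ultimately have "AE \<omega> in M. prefix_indep I (Z g \<omega>)"
        using transfer indepX[OF I] by blast
      then
      show ?thesis
      proof eventually_elim
        case (elim \<omega>)
        then show ?case
          using prefix_indep_cong[OF _ I(1), of "Z g \<omega>" "signed_act g (\<lambda>i. \<xi> i \<omega>)"] Z by simp
      qed
    next
      case 2
      \<comment> \<open>Negating the last sign makes \<open>h\<close> even. Independence of the
        flipped steps, known from the second collection, transfers along \<open>h\<close>, and the
        flip of \<open>Z h\<close> is the action of the odd element \<open>g\<close>.\<close>
      define h where "h = (fst g, (snd g)(n := - snd g n))"
      have nI: "{1..n} = insert n {1..<n}" using n by auto
      have "(\<Prod>i\<in>{1..<n}. ((snd g)(n := - snd g n)) i) = (\<Prod>i\<in>{1..<n}. snd g i)"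
        by (rule prod.cong) auto
      then have "(\<Prod>i\<in>{1..n}. snd h i) = 1" using 2 unfolding nI h_def by simp
      moreover have "snd h \<in> {1..n} \<rightarrow>\<^sub>E {-1, 1}"
      proof (rule PiE_I)
        fix i assume "i \<in> {1..n}"
        then show "snd h i \<in> {-1, 1}" using sg[of i] by (auto simp: h_def)
      next
        fix i assume "i \<notin> {1..n}"
        then show "snd h i = undefined"
          using g n by (auto simp: h_def signed_perms_def PiE_def extensional_def)
      qed
      ultimately have h: "h \<in> even_signed_perms n"
        using g by (auto simp: signed_perms_def even_signed_perms_def h_def)
      have "{x \<in> space N. prefix_indep I (\<lambda>i. if i = n then - x i else x i)} \<in> sets N"
        by (rule sets_prefix_indep[OF _ I]) (use mc in \<open>auto intro!: borel_measurable_uminus\<close>)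
      from transfer[OF this[folded flip_def] indepF[OF I] h]
      show ?thesis
      proof eventually_elim
        case (elim \<omega>)
        have "flip (Z h \<omega>) i = signed_act g (\<lambda>i. \<xi> i \<omega>) i" if "i \<in> {1..n}" for i
          using that by (simp add: flip_def Z_def h_def signed_act_def)
        then show ?case
          using elim prefix_indep_cong[OF _ I(1), of "flip (Z h \<omega>)" "signed_act g (\<lambda>i. \<xi> i \<omega>)"] by simp
      qed
    qed
  qed
  \<comment> \<open>Finitely many pairs of \<open>g\<close> and \<open>I\<close> share one null set,
    outside of which the relations are generic and the count is constant.\<close>
  have "AE \<omega> in M. \<forall>g\<in>signed_perms n. \<forall>I\<in>{I. I \<subseteq> {1..n} \<and> card I = CARD('d)}.
      prefix_indep I (signed_act g (\<lambda>i. \<xi> i \<omega>))"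
    using indep finite_signed_perms[of n] by (intro AE_finite_allI) auto
  then have count: "AE \<omega> in M. real (card {g \<in> even_signed_perms n. hull_event n (signed_act g (\<lambda>i. \<xi> i \<omega>))}) =
      real_of_int (2 * (\<Sum>j\<le>n. Dcoef n (CARD('d) + 1 + 2 * j)))"
  proof eventually_elim
    case (elim \<omega>)
    have "generic {1..n} DIM(real ^ 'd) (relations n (\<lambda>i. \<xi> i \<omega>))"
      by (rule generic_relations) (use elim \<open>n \<ge> CARD('d)\<close> in auto)
    then have "generic {1..n} CARD('d) (relations n (\<lambda>i. \<xi> i \<omega>))" by simp
    note eq = card_hull_events[OF n \<open>n \<ge> CARD('d)\<close> this]
    show ?case unfolding eq[symmetric] by simp
  qed
  have ZE: "hull_event n (Z g \<omega>) \<longleftrightarrow> hull_event n (signed_act g (\<lambda>i. \<xi> i \<omega>))" for g \<omega>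
    by (rule hull_event_cong) (use n Z in auto)
  have XE: "hull_event n (X \<omega>) \<longleftrightarrow> hull_event n (\<lambda>i. \<xi> i \<omega>)" for \<omega>
    by (rule hull_event_cong) (use n in \<open>auto simp: X_def\<close>)
  have mE: "{x \<in> space N. hull_event n x} \<in> sets N"
    by (rule sets_hull_event) (use mc n in auto)
  have vimage: "f -` {x \<in> space N. hull_event n x} \<inter> space M = {\<omega> \<in> space M. hull_event n (f \<omega>)}"
    if "f \<in> measurable M N" for f
    using measurable_space[OF that] by auto
  have prob: "prob {\<omega> \<in> space M. hull_event n (signed_act g (\<lambda>i. \<xi> i \<omega>))} =
      prob {\<omega> \<in> space M. hull_event n (\<lambda>i. \<xi> i \<omega>)}"
    if g: "g \<in> even_signed_perms n" for g
    using measure_distr[OF mX mE] measure_distr[OF mZ[OF even_signed_permsD(1)[OF g]] mE] dist[OF g]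
    unfolding vimage[OF mX] vimage[OF mZ[OF even_signed_permsD(1)[OF g]]] ZE XE by simp
  have ev: "{\<omega> \<in> space M. hull_event n (signed_act g (\<lambda>i. \<xi> i \<omega>))} \<in> events"
    if g: "g \<in> even_signed_perms n" for g
    using measurable_sets[OF mZ[OF even_signed_permsD(1)[OF g]] mE]
    unfolding vimage[OF mZ[OF even_signed_permsD(1)[OF g]]] ZE .
  \<comment> \<open>The expected count is a sum of equal probabilities, one for each group element,
    and it equals the constant.\<close>
  have "real (card (even_signed_perms n)) * prob {\<omega> \<in> space M. hull_event n (\<lambda>i. \<xi> i \<omega>)} =
      real_of_int (2 * (\<Sum>j\<le>n. Dcoef n (CARD('d) + 1 + 2 * j)))"
    using sum_prob_eq_const_count[OF finite_even_signed_perms ev count] prob by simp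
  moreover have "hull_event n (\<lambda>i. \<xi> i \<omega>) \<longleftrightarrow>
      0 \<in> convex hull ((\<lambda>k. psum \<xi> k \<omega>) ` {1..n} \<union> {psum_star \<xi> n \<omega>})" for \<omega>
    by (simp add: hull_event_def psum_def psum_star_def)
  ultimately have "2 ^ (n - 1) * fact n * measure M {\<omega> \<in> space M.
      0 \<in> convex hull ((\<lambda>k. psum \<xi> k \<omega>) ` {1..n} \<union> {psum_star \<xi> n \<omega>})} =
      2 * (\<Sum>j\<le>n. real_of_int (Dcoef n (CARD('d) + 1 + 2 * j)))"
    by (simp add: card_even_signed_perms[OF n])
  then show ?thesis by (simp add: field_simps)
qed

end
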